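(* Let $P=(X,\prec)$ be a poset with $|X|=n$, let $z_1\prec z_2\prec z_3$ be distinct elements of $X$, and let $k,\ell\ge1$ be integers. Let $\mathrm{F}(a,b)$ be the number of linear extensions $L$ of $P$ with $L(z_2)-L(z_1)=a$ and $L(z_3)-L(z_2)=b$. Suppose that $\mathrm{F}(k+2,\ell)>0$ and $\mathrm{F}(k,\ell+2)=0$. Then $$\mathrm{F}(k+1,\ell)\,\mathrm{F}(k,\ell+1)\ \ge\ \mathrm{F}(k,\ell)\,\mathrm{F}(k+1,\ell+1)\Big(\tfrac12+\tfrac{1}{16nk\ell^2}\Big).$$
   Context: A linear extension of $P$ is a bijection $L:X\to\{1,\dots,n\}$ with $L(u)<L(v)$ whenever $u\prec v$. *)

theory Defs
  imports Complex_Main "HOL-Library.FuncSet"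
begin

text \<open>A finite poset is given by its carrier \<open>X\<close> and its strict order \<open>prec\<close>, of which only the
  values on \<open>X\<close> matter.\<close>

definition finite_poset :: "'a set \<Rightarrow> ('a \<Rightarrow> 'a \<Rightarrow> bool) \<Rightarrow> bool" where
  "finite_poset X prec \<longleftrightarrow> finite X \<and> irreflp_on X prec \<and> transp_on X prec"

text \<open>Membership in \<open>extensional X\<close> fixes the values outside \<open>X\<close>, so that maps agreeing on \<open>X\<close>
  are counted once.\<close>

definition linear_extensions :: "'a set \<Rightarrow> ('a \<Rightarrow> 'a \<Rightarrow> bool) \<Rightarrow> ('a \<Rightarrow> nat) set" where
  "linear_extensions X prec =
    {L \<in> extensional X. bij_betw L X {1..card X} \<and>
       (\<forall>u\<in>X. \<forall>v\<in>X. prec u v \<longrightarrow> L u < L v)}"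

definition lin_ext_gap_count ::
    "'a set \<Rightarrow> ('a \<Rightarrow> 'a \<Rightarrow> bool) \<Rightarrow> 'a \<Rightarrow> 'a \<Rightarrow> 'a \<Rightarrow> nat \<Rightarrow> nat \<Rightarrow> nat" where
  "lin_ext_gap_count X prec z1 z2 z3 a b =
    card {L \<in> linear_extensions X prec.
            int (L z2) - int (L z1) = int a \<and> int (L z3) - int (L z2) = int b}"

end

theory Submission
  imports Defs "HOL-Analysis.Function_Topology"
begin

text \<open>If \<open>F(k,l)\<close> and \<open>F(k+1,l+1)\<close> are positive, moving elements across \<open>z1\<close>, \<open>z2\<close>, \<open>z3\<close> shows that
  \<open>F(k,l+2) = 0\<close> forces exactly \<open>l\<close> elements to be neither \<open>\<preceq> z2\<close> nor \<open>\<succeq> z3\<close>. Fixing the part of a linear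
  extension from \<open>z2\<close> on, what remains is a linear extension of \<open>D = {x. x \<prec> z2}\<close> or of \<open>D\<close> together with
  one new maximal element \<open>m\<close>. Writing \<open>N_Y(b)\<close> for the number of linear extensions of \<open>Y\<close> with \<open>b\<close> elements
  after \<open>z1\<close>, it suffices to compare \<open>Y = D + m\<close> with \<open>D\<close>, and for this one needs
  \<open>N_D(b+1)\<^sup>2 N_Y(b) + N_D(b)\<^sup>2 N_Y(b+2) \<le> 2 N_D(b) N_D(b+1) N_Y(b+1)\<close>
  and crude bounds on the ratios of consecutive \<open>N_Y(b)\<close>.

  The inequality expresses that a quadratic form indexed by the minimal and maximal elements of \<open>Y\<close>
  has at most one positive eigenvalue. This is a combinatorial Alexandrov--Fenchel inequality, proved by
  induction on \<open>\<bar>Y\<bar>\<close> as in the Bochner method and the combinatorial atlas of Chan and Pak: the forms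
  of the posets \<open>Y - x\<close> show that every positive eigenvalue of the normalised form of \<open>Y\<close> is at least \<open>1\<close>, and
  Perron--Frobenius that \<open>1\<close> is the largest and simple.\<close>

section \<open>Symmetric forms with one positive direction\<close>

text \<open>Vectors are functions on the whole index type that vanish off \<open>I\<close>. The
  slice is closed in a product of compact sets, so Tychonoff applies; a Rayleigh quotient will be
  maximised on it.\<close>

lemma compact_weighted_sphere_slice:
  fixes D h :: "'i \<Rightarrow> real"
  assumes fin: "finite I" and D: "\<And>i. i \<in> I \<Longrightarrow> D i > 0"
  shows "compact {v. (\<forall>i. i \<notin> I \<longrightarrow> v i = 0) \<and> (\<Sum>i\<in>I. D i * (v i)\<^sup>2) = 1 \<and> (\<Sum>i\<in>I. D i * h i * v i) = 0}"
    (is "compact ?S")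
proof -
  \<comment> \<open>The square of \<open>1 + 1 / D i\<close> exceeds \<open>1 / D i\<close>, which
    bounds \<open>(v i)\<^sup>2\<close>; this avoids square roots.\<close>
  define A where "A i = (if i \<in> I then {-(1 + 1 / D i)..1 + 1 / D i} else {0})" for i
  have "compactin (product_topology (\<lambda>i. euclidean) UNIV) (PiE UNIV A)"
    by (simp add: compactin_PiE A_def)
  then have cA: "compact (PiE UNIV A)"
    by (simp add: euclidean_product_topology)
  let ?C = "{v. (\<Sum>i\<in>I. D i * (v i)\<^sup>2) = 1} \<inter> {v. (\<Sum>i\<in>I. D i * h i * v i) = 0}"
  have cl: "closed ?C"
    by (intro closed_Int closed_Collect_eq continuous_intros continuous_on_product_coordinates)
  have "?S = PiE UNIV A \<inter> ?C"
  proof (intro subset_antisym subsetI)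
    fix v assume v: "v \<in> ?S"
    have "v i \<in> A i" for i
    proof (cases "i \<in> I")
      case True
      have "D i * (v i)\<^sup>2 \<le> (\<Sum>i\<in>I. D i * (v i)\<^sup>2)"
        using D by (intro member_le_sum[OF True _ fin]) (auto simp: less_imp_le)
      then have "D i * (v i)\<^sup>2 \<le> 1" using v by simp
      then have "(v i)\<^sup>2 \<le> 1 / D i" using D[OF True] by (simp add: field_simps)
      also have "\<dots> \<le> (1 + 1 / D i)\<^sup>2" using D[OF True] by (simp add: power2_eq_square field_simps)
      finally have "\<bar>v i\<bar> \<le> \<bar>1 + 1 / D i\<bar>" by (simp only: abs_le_square_iff)
      then have "\<bar>v i\<bar> \<le> 1 + 1 / D i" using D[OF True] by simp
      then show ?thesis using True by (auto simp: A_def abs_le_iff)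
    next
      case False
      then show ?thesis using v by (simp add: A_def)
    qed
    then show "v \<in> PiE UNIV A \<inter> ?C" using v by auto
  next
    fix v assume v: "v \<in> PiE UNIV A \<inter> ?C"
    have "v i = 0" if "i \<notin> I" for i
      using v that by (auto simp: A_def PiE_def Pi_def dest!: spec[of _ i])
    then show "v \<in> ?S" using v by auto
  qed
  then show ?thesis using compact_Int_closed[OF cA cl] by simp
qed

section \<open>Bilinear forms and the reversed Cauchy-Schwarz inequality\<close>

definition bform :: "'i set \<Rightarrow> ('i \<Rightarrow> 'i \<Rightarrow> real) \<Rightarrow> ('i \<Rightarrow> real) \<Rightarrow> ('i \<Rightarrow> real) \<Rightarrow> real" where
  "bform I M u v = (\<Sum>i\<in>I. u i * (\<Sum>j\<in>I. M i j * v j))"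

lemma bform_add_left: "bform I M (\<lambda>i. u i + t * w i) v = bform I M u v + t * bform I M w v"
  by (simp add: bform_def algebra_simps sum.distrib sum_distrib_left)

lemma bform_add_right: "bform I M v (\<lambda>i. u i + t * w i) = bform I M v u + t * bform I M v w"
  by (simp add: bform_def algebra_simps sum.distrib sum_distrib_left)

lemma bform_sym:
  assumes "\<And>i j. i \<in> I \<Longrightarrow> j \<in> I \<Longrightarrow> M i j = M j i"
  shows "bform I M u v = bform I M v u"
proof -
  have "bform I M u v = (\<Sum>i\<in>I. \<Sum>j\<in>I. u i * M i j * v j)"
    by (simp add: bform_def sum_distrib_left mult.assoc)
  also have "\<dots> = (\<Sum>j\<in>I. \<Sum>i\<in>I. u i * M i j * v j)" by (rule sum.swap)
  also have "\<dots> = bform I M v u"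
    unfolding bform_def sum_distrib_left using assms
    by (intro sum.cong refl) (simp add: mult.commute mult.left_commute)
  finally show ?thesis .
qed

text \<open>For a symmetric form on a finite-dimensional space this says that there is at most one
  positive eigenvalue.\<close>

definition hyperbolic :: "(('i \<Rightarrow> real) \<Rightarrow> ('i \<Rightarrow> real) \<Rightarrow> real) \<Rightarrow> bool" where
  "hyperbolic B \<longleftrightarrow> (\<forall>u v. B u u > 0 \<longrightarrow> B u u * B v v \<le> (B u v)\<^sup>2)"

text \<open>For small \<open>t\<close> the linear term dominates; this is the first-order condition
  at an extremum.\<close>

lemma quadratic_nonneg_imp_linear_coeff_zero:
  fixes p q :: real
  assumes "\<And>t. 2 * t * p + t\<^sup>2 * q \<ge> 0"
  shows "p = 0"
proof (rule ccontr)
  assume "p \<noteq> 0"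
  define c where "c = 1 + \<bar>q\<bar>"
  have c: "c > 0" "q < c" by (auto simp: c_def)
  have "2 * (-p / c) * p + (-p / c)\<^sup>2 * q = (p\<^sup>2 / c) * (q / c - 2)"
    using c by (simp add: field_simps power2_eq_square)
  moreover have "q / c - 2 < 0" using c by (simp add: field_simps)
  moreover have "p\<^sup>2 / c > 0" using c \<open>p \<noteq> 0\<close> by simp
  ultimately have "2 * (-p / c) * p + (-p / c)\<^sup>2 * q < 0" using mult_pos_neg by metis
  with assms[of "-p / c"] show False by linarith
qed

text \<open>A vector \<open>u\<close> of positive square is not orthogonal to \<open>h\<close>, so
  subtracting a multiple of \<open>u\<close> moves any \<open>v\<close> into the complement of
  \<open>h\<close>; the sign there gives the claim by completing a square.\<close>

lemma hyperbolicI_of_negative_complement: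
  assumes sym: "\<And>i j. i \<in> I \<Longrightarrow> j \<in> I \<Longrightarrow> M i j = M j i"
    and neg: "\<And>w. bform I M w h = 0 \<Longrightarrow> bform I M w w \<le> 0"
  shows "hyperbolic (bform I M)"
  unfolding hyperbolic_def
proof (intro allI impI)
  fix u v assume u: "bform I M u u > 0"
  have uh: "bform I M u h \<noteq> 0" using neg[of u] u by fastforce
  define c where "c = bform I M v h / bform I M u h"
  define w where "w = (\<lambda>i. v i + (- c) * u i)"
  have "bform I M w h = 0"
    unfolding w_def bform_add_left using uh by (simp add: c_def)
  from neg[OF this] have "bform I M v v - 2 * c * bform I M u v + c\<^sup>2 * bform I M u u \<le> 0"
    unfolding w_def bform_add_left bform_add_right
    using bform_sym[OF sym, where u = u and v = v] by (simp add: algebra_simps power2_eq_square)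
  then have "bform I M u u * (bform I M v v - 2 * c * bform I M u v + c\<^sup>2 * bform I M u u) \<le> 0"
    using u by (simp add: mult_le_0_iff)
  moreover have "(bform I M u v - c * bform I M u u)\<^sup>2 \<ge> 0" by simp
  ultimately show "bform I M u u * bform I M v v \<le> (bform I M u v)\<^sup>2"
    by (simp add: algebra_simps power2_eq_square)
qed

text \<open>With \<open>D = diag (b i / h i)\<close>, the operator \<open>A = D\<inverse>M\<close> is selfadjoint for the inner product of \<open>D\<close> and
  fixes \<open>h\<close>. The last hypothesis reads \<open>A \<le> A\<^sup>2\<close>, so an eigenvalue \<open>L > 0\<close> of \<open>A\<close> on the complement of \<open>h\<close> has
  \<open>L \<ge> 1\<close>; the Dirichlet form of \<open>1 - A\<close> and connectedness exclude this.\<close>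

lemma hyperbolic_of_contraction:
  fixes M :: "'i \<Rightarrow> 'i \<Rightarrow> real" and h :: "'i \<Rightarrow> real"
  assumes fin: "finite I"
    and sym: "\<And>i j. i \<in> I \<Longrightarrow> j \<in> I \<Longrightarrow> M i j = M j i"
    and nn: "\<And>i j. i \<in> I \<Longrightarrow> j \<in> I \<Longrightarrow> M i j \<ge> 0"
    and h: "\<And>i. i \<in> I \<Longrightarrow> h i > 0"
    and b: "\<And>i. i \<in> I \<Longrightarrow> b i = (\<Sum>j\<in>I. M i j * h j)" "\<And>i. i \<in> I \<Longrightarrow> b i > 0"
    and conn: "\<And>i j. i \<in> I \<Longrightarrow> j \<in> I \<Longrightarrow> i \<noteq> j \<Longrightarrow> M i j > 0 \<or> (\<exists>k\<in>I. M i k > 0 \<and> M k j > 0)"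
    and contr: "\<And>v. bform I M v v \<le> (\<Sum>i\<in>I. h i * (\<Sum>j\<in>I. M i j * v j)\<^sup>2 / b i)"
  shows "hyperbolic (bform I M)"
proof (rule hyperbolicI_of_negative_complement[OF sym, where h = h])
  define D where "D i = b i / h i" for i
  have D: "D i > 0" if "i \<in> I" for i using that h b(2) by (simp add: D_def)
  have Dh: "D i * h i = b i" if "i \<in> I" for i using h[OF that] by (simp add: D_def)
  let ?B = "bform I M"
  define ip where "ip u v = (\<Sum>i\<in>I. D i * u i * v i)" for u v
  have ip_l: "ip (\<lambda>i. u i + t * w i) v = ip u v + t * ip w v" for u w v t
    by (simp add: ip_def algebra_simps sum.distrib sum_distrib_left)
  have ip_r: "ip v (\<lambda>i. u i + t * w i) = ip v u + t * ip v w" for u w v t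
    by (simp add: ip_def algebra_simps sum.distrib sum_distrib_left)
  have ip_sym: "ip u v = ip v u" for u v by (simp add: ip_def mult.commute mult.left_commute)
  have Bsym: "?B u v = ?B v u" for u v by (rule bform_sym[OF sym])
  have Bh: "?B u h = ip u h" for u
    unfolding bform_def ip_def
    by (intro sum.cong refl) (simp add: b(1)[symmetric] Dh[symmetric])
  \<comment> \<open>Expanding the square, the row sums \<open>b i\<close> of \<open>M\<close>
    against \<open>h\<close> turn both pure squares into \<open>ip v v\<close>.\<close>
  have dirichlet: "2 * (ip v v - ?B v v) = (\<Sum>i\<in>I. \<Sum>j\<in>I. M i j * h i * h j * (v i / h i - v j / h j)\<^sup>2)" for v
  proof -
    have e: "M i j * h i * h j * (v i / h i - v j / h j)\<^sup>2
        = M i j * h j * (v i)\<^sup>2 / h i + M i j * h i * (v j)\<^sup>2 / h j - 2 * (v i * (M i j * v j))"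
      if "i \<in> I" "j \<in> I" for i j
      using h[OF that(1)] h[OF that(2)] by (simp add: field_simps power2_eq_square)
    have "(\<Sum>i\<in>I. \<Sum>j\<in>I. M i j * h j * (v i)\<^sup>2 / h i) = (\<Sum>i\<in>I. (\<Sum>j\<in>I. M i j * h j) * ((v i)\<^sup>2 / h i))"
      by (simp add: sum_distrib_right sum_divide_distrib)
    also have "\<dots> = ip v v"
      unfolding ip_def using b(1) by (intro sum.cong) (auto simp: D_def power2_eq_square)
    finally have s1: "(\<Sum>i\<in>I. \<Sum>j\<in>I. M i j * h j * (v i)\<^sup>2 / h i) = ip v v" .
    have "(\<Sum>i\<in>I. \<Sum>j\<in>I. M i j * h i * (v j)\<^sup>2 / h j) = (\<Sum>i\<in>I. \<Sum>j\<in>I. M i j * h j * (v i)\<^sup>2 / h i)"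
      by (subst sum.swap) (intro sum.cong refl, simp add: sym)
    then have s2: "(\<Sum>i\<in>I. \<Sum>j\<in>I. M i j * h i * (v j)\<^sup>2 / h j) = ip v v" using s1 by simp
    show ?thesis
      by (simp add: e sum.distrib sum_subtractf s1 s2 bform_def sum_distrib_left)
  qed
  \<comment> \<open>Every Dirichlet term vanishes here, so \<open>v / h\<close> is constant along
    positive entries, hence constant by \<open>conn\<close>; orthogonality to \<open>h\<close> makes
    the constant 0.\<close>
  have fixed: "v = (\<lambda>_. 0)"
    if supp: "\<And>i. i \<notin> I \<Longrightarrow> v i = 0" and le: "ip v v \<le> ?B v v" and orth: "ip v h = 0" for v
  proof (cases "I = {}")
    case True then show ?thesis using supp by auto
  next
    case False
    then obtain i0 where i0: "i0 \<in> I" by auto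
    have t0: "M i j * h i * h j * (v i / h i - v j / h j)\<^sup>2 \<ge> 0" if "i \<in> I" "j \<in> I" for i j
      using that h nn by (simp add: less_imp_le)
    define q where "q i j = M i j * h i * h j * (v i / h i - v j / h j)\<^sup>2" for i j
    have q: "q i j \<ge> 0" if "i \<in> I" "j \<in> I" for i j using t0 that by (simp add: q_def)
    have q': "(\<Sum>j\<in>I. q i j) \<ge> 0" if "i \<in> I" for i using q that by (simp add: sum_nonneg)
    have "(\<Sum>i\<in>I. \<Sum>j\<in>I. q i j) \<le> 0"
      using le dirichlet[of v] by (simp add: q_def)
    then have "(\<Sum>i\<in>I. \<Sum>j\<in>I. q i j) = 0"
      by (rule antisym) (intro sum_nonneg q)
    then have "(\<Sum>j\<in>I. q i j) = 0" if "i \<in> I" for i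
      using that q' sum_nonneg_eq_0_iff[OF fin, of "\<lambda>i. \<Sum>j\<in>I. q i j"] by simp
    then have "q i j = 0" if "i \<in> I" "j \<in> I" for i j
      using that q sum_nonneg_eq_0_iff[OF fin, of "q i"] by simp
    then have "M i j * h i * h j * (v i / h i - v j / h j)\<^sup>2 = 0" if "i \<in> I" "j \<in> I" for i j
      using that by (simp add: q_def)
    then have adj: "v i / h i = v j / h j" if "i \<in> I" "j \<in> I" "M i j > 0" for i j
      using that h[of i] h[of j] by fastforce
    have const: "v i / h i = v i0 / h i0" if "i \<in> I" for i
      using conn[OF that i0] adj that i0 by metis
    define c where "c = v i0 / h i0"
    have v: "v i = c * h i" if "i \<in> I" for i
      using const[OF that] h[OF that] by (simp add: c_def field_simps)
    have "ip v h = c * (\<Sum>i\<in>I. D i * h i * h i)"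
      by (simp add: ip_def v sum_distrib_left mult.commute mult.left_commute)
    moreover have "(\<Sum>i\<in>I. D i * h i * h i) > 0"
      using D h fin False by (intro sum_pos) auto
    ultimately have "c = 0" using orth by simp
    then show ?thesis using v supp by fastforce
  qed
  fix w assume w: "?B w h = 0"
  show "?B w w \<le> 0"
  proof (rule ccontr)
    assume pos: "\<not> ?B w w \<le> 0"
    let ?S = "{v. (\<forall>i. i \<notin> I \<longrightarrow> v i = 0) \<and> (\<Sum>i\<in>I. D i * (v i)\<^sup>2) = 1 \<and> (\<Sum>i\<in>I. D i * h i * v i) = 0}"
    have S: "v \<in> ?S \<longleftrightarrow> (\<forall>i. i \<notin> I \<longrightarrow> v i = 0) \<and> ip v v = 1 \<and> ip v h = 0" for v
      by (simp add: ip_def power2_eq_square mult.assoc mult.left_commute mult.commute)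
    define nrm where "nrm u = (\<lambda>i. if i \<in> I then u i / sqrt (ip u u) else 0)" for u
    have nrm: "nrm u \<in> ?S" "?B (nrm u) (nrm u) = ?B u u / ip u u"
      if "ip u h = 0" "ip u u > 0" for u
    proof -
      have "ip (nrm u) (nrm u) = ip u u / (sqrt (ip u u) * sqrt (ip u u))"
        by (simp add: ip_def nrm_def sum_divide_distrib)
      then have 1: "ip (nrm u) (nrm u) = 1" using that by simp
      have "ip (nrm u) h = ip u h / sqrt (ip u u)"
        by (simp add: ip_def nrm_def sum_divide_distrib)
      then show "nrm u \<in> ?S" using 1 that by (simp only: S) (simp add: nrm_def)
      have "?B (nrm u) (nrm u) = ?B u u / (sqrt (ip u u) * sqrt (ip u u))"
        by (simp add: bform_def nrm_def sum_divide_distrib sum_distrib_left)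
      then show "?B (nrm u) (nrm u) = ?B u u / ip u u" using that by simp
    qed
    have ipnn: "ip u u \<ge> 0" for u
      unfolding ip_def using D by (intro sum_nonneg) (simp add: mult.assoc less_imp_le)
    have ip0: "u i = 0" if "ip u u = 0" "i \<in> I" for u i
    proof -
      have "D i * u i * u i = 0"
        using that fin D unfolding ip_def
        by (subst (asm) sum_nonneg_eq_0_iff) (auto simp: mult.assoc less_imp_le)
      then show ?thesis using D[OF that(2)] by simp
    qed
    have B0: "?B u u = 0" if "ip u u = 0" for u
      unfolding bform_def using ip0[OF that] by simp
    have ipw: "ip w w > 0" using B0[of w] pos ipnn[of w] by fastforce
    have wh: "ip w h = 0" using w Bh by simp
    \<comment> \<open>By compactness the Rayleigh quotient on the complement of \<open>h\<close>
      attains its maximum \<open>L\<close>, positive because of \<open>w\<close>.\<close>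
    have "continuous_on ?S (\<lambda>v. ?B v v)"
      unfolding bform_def
      by (intro continuous_intros continuous_on_subset[OF continuous_on_product_coordinates subset_UNIV])
    moreover have "compact ?S" by (rule compact_weighted_sphere_slice[OF fin D])
    moreover have "?S \<noteq> {}" using nrm(1)[OF wh ipw] by blast
    ultimately obtain v where v: "v \<in> ?S" and vmax: "\<And>u. u \<in> ?S \<Longrightarrow> ?B u u \<le> ?B v v"
      using continuous_attains_sup[of ?S "\<lambda>v. ?B v v"] by blast
    define L where "L = ?B v v"
    have v1: "ip v v = 1" and vh: "ip v h = 0" and vsupp: "\<And>i. i \<notin> I \<Longrightarrow> v i = 0"
      using v unfolding S by auto
    have Lpos: "L > 0"
    proof -
      have "?B w w / ip w w > 0" using pos ipw by simp
      also have "\<dots> \<le> L"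
        using vmax[OF nrm(1)[OF wh ipw]] unfolding nrm(2)[OF wh ipw] L_def .
      finally show ?thesis .
    qed
    have max: "?B u u \<le> L * ip u u" if "ip u h = 0" for u
    proof (cases "ip u u = 0")
      case True then show ?thesis using B0 by simp
    next
      case False
      then have "ip u u > 0" using ipnn[of u] by simp
      with vmax[OF nrm(1)[OF that this]] nrm(2)[OF that this] show ?thesis
        by (simp add: L_def divide_le_eq)
    qed
    \<comment> \<open>First variation at the maximiser: \<open>v\<close> is an eigenvector on the
      complement of \<open>h\<close>.\<close>
    have eig_orth: "?B v u = L * ip v u" if "ip u h = 0" for u
    proof -
      have "2 * t * (L * ip v u - ?B v u) + t\<^sup>2 * (L * ip u u - ?B u u) \<ge> 0" for t
      proof -
        have "ip (\<lambda>i. v i + t * u i) h = 0" by (simp add: ip_l vh that)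
        from max[OF this] show ?thesis
          unfolding ip_l ip_r bform_add_left bform_add_right
          using ip_sym[of u v] Bsym[of u v] v1 L_def
          by (simp add: algebra_simps power2_eq_square)
      qed
      from quadratic_nonneg_imp_linear_coeff_zero[OF this] show ?thesis by simp
    qed
    \<comment> \<open>Both \<open>?B v h\<close> and \<open>ip v h\<close> vanish, so
      \<open>u\<close> may first be projected to the complement of \<open>h\<close>.\<close>
    have eig: "?B v u = L * ip v u" for u
    proof (cases "ip h h = 0")
      case True
      then have "ip u h = 0" using ip0[OF True] by (simp add: ip_def)
      then show ?thesis by (rule eig_orth)
    next
      case False
      define c where "c = ip u h / ip h h"
      have "ip (\<lambda>i. u i + (- c) * h i) h = 0" unfolding ip_l using False by (simp add: c_def)
      from eig_orth[OF this] show ?thesis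
        unfolding bform_add_right ip_r by (simp add: Bh vh)
    qed
    have row: "(\<Sum>j\<in>I. M i j * v j) = L * D i * v i" if i: "i \<in> I" for i
    proof -
      have "?B (\<lambda>j. if j = i then 1 else 0) v = (\<Sum>j\<in>I. M i j * v j)"
        using i fin by (simp add: bform_def if_distrib[of "\<lambda>x. x * _"] cong: if_cong)
      moreover have "ip v (\<lambda>j. if j = i then 1 else 0) = D i * v i"
        using i fin by (simp add: ip_def if_distrib[of "\<lambda>x. _ * x"] cong: if_cong)
      ultimately show ?thesis using eig Bsym by (metis mult.assoc)
    qed
    \<comment> \<open>On an eigenvector the contraction hypothesis becomes
      \<open>L \<le> L\<^sup>2\<close>.\<close>
    have "(\<Sum>i\<in>I. h i * (\<Sum>j\<in>I. M i j * v j)\<^sup>2 / b i) = (\<Sum>i\<in>I. L\<^sup>2 * (D i * v i * v i))"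
    proof (intro sum.cong refl)
      fix i assume i: "i \<in> I"
      show "h i * (\<Sum>j\<in>I. M i j * v j)\<^sup>2 / b i = L\<^sup>2 * (D i * v i * v i)"
        using h[OF i] b(2)[OF i] unfolding row[OF i] by (simp add: D_def field_simps power2_eq_square)
    qed
    also have "\<dots> = L\<^sup>2" using v1 by (simp add: ip_def sum_distrib_left[symmetric])
    finally have "L \<le> L\<^sup>2" using contr[of v] by (simp add: L_def)
    then have "1 \<le> L" using Lpos by (simp add: power2_eq_square)
    then have "v = (\<lambda>_. 0)" using fixed[OF vsupp] v1 vh by (simp add: L_def)
    then show False using v1 by (simp add: ip_def)
  qed
qed

text \<open>The combination of \<open>a\<close> and \<open>c\<close> orthogonal to \<open>e\<close>
  has nonpositive square; expanding it gives the claim.\<close>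

lemma hyperbolic_orthogonal:
  assumes "hyperbolic (bform I M)" "bform I M e e > 0"
    and sym: "\<And>i j. i \<in> I \<Longrightarrow> j \<in> I \<Longrightarrow> M i j = M j i"
  shows "(bform I M e c)\<^sup>2 * bform I M a a + (bform I M e a)\<^sup>2 * bform I M c c
      \<le> 2 * bform I M e a * bform I M e c * bform I M a c"
proof -
  let ?B = "bform I M"
  \<comment> \<open>The leading \<open>0 +\<close> gives both summands the shape of the additivity
    lemmas.\<close>
  define w where "w = (\<lambda>i. (\<lambda>i. 0 + ?B e c * a i) i + (- ?B e a) * c i)"
  have z0: "?B (\<lambda>_. 0) v = 0" "?B v (\<lambda>_. 0) = 0" for v by (simp_all add: bform_def)
  have "?B e w = 0" unfolding w_def bform_add_right z0 by simp
  moreover have "?B e e * ?B w w \<le> (?B e w)\<^sup>2" using assms(1,2) unfolding hyperbolic_def by blast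
  ultimately have "?B w w \<le> 0" using assms(2) by (simp add: mult_le_0_iff)
  then show ?thesis
    unfolding w_def bform_add_right bform_add_left z0
    using bform_sym[OF sym, where u = c and v = a] by (simp add: algebra_simps power2_eq_square)
qed

section \<open>The form on the ends of a poset\<close>

lemma sum_symmetrize:
  fixes g :: "'b \<Rightarrow> 'b \<Rightarrow> real"
  assumes "\<And>i j. i \<in> I \<Longrightarrow> j \<in> I \<Longrightarrow> g i j + g j i \<ge> 0"
  shows "(\<Sum>i\<in>I. \<Sum>j\<in>I. g i j) \<ge> 0"
proof -
  have "2 * (\<Sum>i\<in>I. \<Sum>j\<in>I. g i j) = (\<Sum>i\<in>I. \<Sum>j\<in>I. g i j) + (\<Sum>i\<in>I. \<Sum>j\<in>I. g j i)"
    by (subst (3) sum.swap) simp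
  also have "\<dots> = (\<Sum>i\<in>I. \<Sum>j\<in>I. g i j + g j i)" by (simp add: sum.distrib)
  also have "\<dots> \<ge> 0" using assms by (intro sum_nonneg)
  finally show ?thesis by simp
qed

lemma card_disjoint_images:
  assumes "finite A" "\<And>i. i \<in> A \<Longrightarrow> finite (S i)" "\<And>i. i \<in> A \<Longrightarrow> inj_on (f i) (S i)"
    and "\<And>i j x y. i \<in> A \<Longrightarrow> j \<in> A \<Longrightarrow> x \<in> S i \<Longrightarrow> y \<in> S j \<Longrightarrow> f i x = f j y \<Longrightarrow> i = j"
  shows "card (\<Union>i\<in>A. f i ` S i) = (\<Sum>i\<in>A. card (S i))"
proof -
  have "card (\<Union>i\<in>A. f i ` S i) = (\<Sum>i\<in>A. card (f i ` S i))"
  proof (intro card_UN_disjoint ballI impI)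
    show "f i ` S i \<inter> f j ` S j = {}" if "i \<in> A" "j \<in> A" "i \<noteq> j" for i j
      using assms(4)[OF that(1,2)] that(3) by blast
  qed (use assms in auto)
  then show ?thesis using assms by (simp add: card_image)
qed

text \<open>The order is strict on the whole type, so that it restricts to any \<open>Y\<close>;
  \<open>z\<close> is the element that is never removed.\<close>

locale pointed_order =
  fixes lt :: "'a \<Rightarrow> 'a \<Rightarrow> bool" (infix "\<sqsubset>" 50) and z :: 'a
  assumes lt_irrefl: "\<not> x \<sqsubset> x"
    and lt_trans: "x \<sqsubset> y \<Longrightarrow> y \<sqsubset> w \<Longrightarrow> x \<sqsubset> w"
begin

text \<open>The end \<open>(True, x)\<close> stands for a minimal and \<open>(False, x)\<close> for a maximal element \<open>x \<noteq> z\<close>; an element can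
  provide both.\<close>

definition ends :: "'a set \<Rightarrow> (bool \<times> 'a) set" where
  "ends Y = {(s, x). x \<in> Y \<and> x \<noteq> z \<and> (\<forall>y\<in>Y. \<not> (if s then y \<sqsubset> x else x \<sqsubset> y))}"

abbreviation remove_end :: "'a set \<Rightarrow> bool \<times> 'a \<Rightarrow> 'a set" (infixl "\<ominus>" 65) where
  "Y \<ominus> i \<equiv> Y - {snd i}"

lemma remove_end_commute: "Y \<ominus> i \<ominus> j = Y \<ominus> j \<ominus> i"
  by auto

lemma finite_ends: "finite Y \<Longrightarrow> finite (ends Y)"
  by (rule finite_subset[of _ "UNIV \<times> Y"]) (auto simp: ends_def)

lemma ends_remove_end: "j \<in> ends Y \<Longrightarrow> snd j \<noteq> snd i \<Longrightarrow> j \<in> ends (Y \<ominus> i)"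
  by (auto simp: ends_def)

lemma ends_mem: "j \<in> ends Y \<Longrightarrow> snd j \<in> Y \<and> snd j \<noteq> z"
  by (auto simp: ends_def)

text \<open>An element freed by removing a minimal element lies above it, so it becomes minimal;
  dually for maximal elements.\<close>

lemma new_end_same_side:
  "i \<in> ends Y \<Longrightarrow> j \<in> ends (Y \<ominus> i) \<Longrightarrow> j \<notin> ends Y \<Longrightarrow> fst j = fst i"
  by (auto simp: ends_def split: if_splits)

text \<open>Any element that prevents \<open>k\<close> from being an end survives at least one of
  the two removals.\<close>

lemma ends_two_removals:
  assumes "snd i \<noteq> snd j" "k \<in> ends (Y \<ominus> i)" "k \<in> ends (Y \<ominus> j)"
  shows "k \<in> ends Y"
proof -
  obtain s x where k: "k = (s, x)" by (cases k)
  have "y \<in> Y \<ominus> i \<or> y \<in> Y \<ominus> j" if "y \<in> Y" for y using that assms(1) by auto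
  then show ?thesis using assms(2,3) unfolding k ends_def by fastforce
qed

lemma ends_split:
  assumes "finite Y" "i \<in> ends Y"
  shows "sum f (ends (Y \<ominus> i)) =
    (\<Sum>j\<in>{j \<in> ends Y. snd j \<noteq> snd i}. f j) + sum f (ends (Y \<ominus> i) - ends Y)"
proof -
  have "ends (Y \<ominus> i) = {j \<in> ends Y. snd j \<noteq> snd i} \<union> (ends (Y \<ominus> i) - ends Y)"
    using ends_remove_end[of _ Y i] ends_mem[of _ "Y \<ominus> i"] by blast
  moreover have "finite (ends Y)" "finite (ends (Y \<ominus> i))"
    using assms by (auto intro: finite_ends)
  ultimately show ?thesis
    by (metis (no_types, lifting) DiffE disjoint_iff finite_Diff finite_Un mem_Collect_eq sum.union_disjoint)
qed

lemma lt_asymp_on: "asymp_on A (\<sqsubset>)"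
  by (rule asymp_onI) (use lt_irrefl lt_trans in blast)

lemma lt_transp_on: "transp_on A (\<sqsubset>)"
  by (rule transp_onI) (rule lt_trans)

text \<open>If something lies below \<open>z\<close>, a minimal element there is minimal in
  \<open>Y\<close>; otherwise a maximal element of \<open>Y - {z}\<close> is maximal in
  \<open>Y\<close>, as it is not below \<open>z\<close>.\<close>

lemma ends_nonempty:
  assumes fin: "finite Y" and z: "z \<in> Y" and card: "card Y \<ge> 2"
  shows "ends Y \<noteq> {}"
proof (cases "\<exists>x\<in>Y. x \<sqsubset> z")
  case True
  let ?A = "{x \<in> Y. x \<sqsubset> z}"
  have "finite ?A" "?A \<noteq> {}" using fin True by auto
  then obtain m where m: "m \<in> ?A" "\<forall>x\<in>?A. x \<noteq> m \<longrightarrow> \<not> x \<sqsubset> m"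
    using Finite_Set.bex_min_element[OF _ lt_asymp_on lt_transp_on] by blast
  have "(True, m) \<in> ends Y"
  proof -
    have "\<not> y \<sqsubset> m" if "y \<in> Y" for y
      using m that lt_irrefl[of m] lt_trans[of y m z] by auto
    then show ?thesis using m lt_irrefl by (auto simp: ends_def)
  qed
  then show ?thesis by blast
next
  case False
  let ?A = "Y - {z}"
  have "?A \<noteq> {}"
  proof
    assume "?A = {}"
    then have "Y \<subseteq> {z}" by auto
    then have "card Y \<le> card {z}" by (intro card_mono) auto
    then show False using card by simp
  qed
  moreover have "finite ?A" using fin by simp
  ultimately obtain m where m: "m \<in> ?A" "\<forall>x\<in>?A. x \<noteq> m \<longrightarrow> \<not> m \<sqsubset> x"
    using Finite_Set.bex_max_element[OF _ lt_asymp_on lt_transp_on] by blast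
  have "(False, m) \<in> ends Y"
  proof -
    have "\<not> m \<sqsubset> y" if "y \<in> Y" for y
      using m that lt_irrefl[of m] False by auto
    then show ?thesis using m by (auto simp: ends_def)
  qed
  then show ?thesis by blast
qed

section \<open>Weights of removal sequences and the form they define\<close>

text \<open>Up to a factorial, \<open>wgt ps Y\<close> is the mixed volume of slices of the order polytope of \<open>Y\<close>, the list entry
  \<open>p\<close> standing for the body with lower bounds \<open>- p True\<close> and upper bounds \<open>p False\<close>.\<close>

fun wgt :: "(bool \<Rightarrow> real) list \<Rightarrow> 'a set \<Rightarrow> real" where
  "wgt [] Y = 1"
| "wgt (p # ps) Y = (\<Sum>i\<in>ends Y. p (fst i) * wgt ps (Y \<ominus> i))"

text \<open>An element that becomes an end by the removal of \<open>i\<close> takes over the value of \<open>i\<close>.\<close>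

definition inherit :: "'a set \<Rightarrow> bool \<times> 'a \<Rightarrow> (bool \<times> 'a \<Rightarrow> real) \<Rightarrow> bool \<times> 'a \<Rightarrow> real" where
  "inherit Y i v j = (if j \<in> ends Y then v j else v i)"

text \<open>The product of the matrix \<open>mat\<close> with \<open>v\<close> (see
  \<open>row_eq_mat\<close>), phrased through \<open>inherit\<close> so that it can be iterated over
  successive removals.\<close>

definition row :: "(bool \<Rightarrow> real) list \<Rightarrow> 'a set \<Rightarrow> (bool \<times> 'a \<Rightarrow> real) \<Rightarrow> bool \<times> 'a \<Rightarrow> real" where
  "row ps Y v i = (\<Sum>j\<in>ends (Y \<ominus> i). wgt ps (Y \<ominus> i \<ominus> j) * inherit Y i v j)"

text \<open>The diagonal collects the elements freed by removing \<open>i\<close>, because these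
  inherit \<open>v i\<close>; the two ends at one element do not interact.\<close>

definition mat :: "(bool \<Rightarrow> real) list \<Rightarrow> 'a set \<Rightarrow> bool \<times> 'a \<Rightarrow> bool \<times> 'a \<Rightarrow> real" where
  "mat ps Y i j =
    (if snd i \<noteq> snd j then wgt ps (Y \<ominus> i \<ominus> j)
     else if i = j then \<Sum>k\<in>ends (Y \<ominus> i) - ends Y. wgt ps (Y \<ominus> i \<ominus> k) else 0)"

abbreviation form where "form ps Y \<equiv> bform (ends Y) (mat ps Y)"

lemma mat_sym: "mat ps Y i j = mat ps Y j i"
  by (simp add: mat_def remove_end_commute[of Y i j])

lemma row_eq_mat:
  assumes "finite Y" "i \<in> ends Y"
  shows "(\<Sum>j\<in>ends Y. mat ps Y i j * v j) = row ps Y v i"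
proof -
  let ?A = "{j \<in> ends Y. snd j \<noteq> snd i}"
  have fin: "finite (ends Y)" using assms by (simp add: finite_ends)
  have "(\<Sum>j\<in>ends Y. mat ps Y i j * v j) = (\<Sum>j\<in>insert i ?A. mat ps Y i j * v j)"
  proof (intro sum.mono_neutral_right fin ballI)
    show "insert i ?A \<subseteq> ends Y" using assms by blast
    fix j assume "j \<in> ends Y - insert i ?A"
    then have "snd i = snd j" "i \<noteq> j" by auto
    then show "mat ps Y i j * v j = 0" by (simp only: mat_def if_False simp_thms mult_zero_left)
  qed
  also have "\<dots> = mat ps Y i i * v i + (\<Sum>j\<in>?A. mat ps Y i j * v j)"
    using fin by simp
  also have "(\<Sum>j\<in>?A. mat ps Y i j * v j) = (\<Sum>j\<in>?A. wgt ps (Y \<ominus> i \<ominus> j) * inherit Y i v j)"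
    by (intro sum.cong) (auto simp: mat_def inherit_def)
  also have "mat ps Y i i * v i = (\<Sum>j\<in>ends (Y \<ominus> i) - ends Y. wgt ps (Y \<ominus> i \<ominus> j) * inherit Y i v j)"
    unfolding mat_def by (simp add: sum_distrib_right inherit_def)
  finally show ?thesis
    unfolding row_def ends_split[OF assms] by simp
qed

lemma form_eq:
  assumes "finite Y"
  shows "form ps Y u v = (\<Sum>i\<in>ends Y. u i * row ps Y v i)"
  unfolding bform_def using row_eq_mat[OF assms] by simp

lemma form_sym: "form ps Y u v = form ps Y v u"
  by (rule bform_sym) (rule mat_sym)

lemma inherit_side:
  assumes "i \<in> ends Y" "j \<in> ends (Y \<ominus> i)"
  shows "inherit Y i (\<lambda>i. p (fst i)) j = p (fst j)"
  using new_end_same_side[OF assms] by (auto simp: inherit_def)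

lemma row_side:
  assumes "i \<in> ends Y"
  shows "row ps Y (\<lambda>i. p (fst i)) i = wgt (p # ps) (Y \<ominus> i)"
  unfolding row_def by (auto simp: inherit_side[OF assms] mult.commute intro: sum.cong)

text \<open>The recursion behind the induction: by \<open>row_side\<close>, pairing the inherited
  vector with \<open>p\<close> on \<open>Y \<ominus> i\<close> adds the body \<open>p\<close> to
  each weight.\<close>

lemma row_Cons:
  assumes "finite Y" "i \<in> ends Y"
  shows "row (p # ps) Y v i = form ps (Y \<ominus> i) (\<lambda>i. p (fst i)) (inherit Y i v)"
proof -
  have "form ps (Y \<ominus> i) (inherit Y i v) (\<lambda>i. p (fst i)) =
      (\<Sum>j\<in>ends (Y \<ominus> i). inherit Y i v j * wgt (p # ps) (Y \<ominus> i \<ominus> j))"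
    using assms by (subst form_eq) (auto intro!: sum.cong simp: row_side simp del: wgt.simps)
  then show ?thesis by (subst form_sym) (simp add: row_def mult.commute)
qed

lemma wgt_nonneg:
  "(\<And>p s. p \<in> set ps \<Longrightarrow> p s \<ge> 0) \<Longrightarrow> wgt ps Y \<ge> 0"
  by (induction ps arbitrary: Y) (auto intro!: sum_nonneg)

text \<open>While elements other than \<open>z\<close> remain there is an end to remove, and the
  list of bodies runs out exactly when only \<open>z\<close> is left.\<close>

lemma wgt_pos:
  assumes "finite Y" "z \<in> Y" "card Y = length ps + 1" "\<And>p s. p \<in> set ps \<Longrightarrow> p s > 0"
  shows "wgt ps Y > 0"
  using assms
proof (induction ps arbitrary: Y)
  case (Cons p ps)
  have ne: "ends Y \<noteq> {}" using Cons.prems by (intro ends_nonempty) auto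
  have "wgt ps (Y \<ominus> i) > 0" if "i \<in> ends Y" for i
    using that Cons.prems ends_mem[OF that] by (intro Cons.IH) auto
  then show ?case using Cons.prems ne by (auto intro!: sum_pos finite_ends)
qed simp

text \<open>After splitting both sides into ends of \<open>Y\<close> and new ends, they differ only by the failure of
  the two removals of \<open>i\<close> and \<open>j\<close> to commute, which stems from the elements freed only by the removal of both;
  symmetrizing in \<open>i\<close> and \<open>j\<close> leaves a sum of squares.\<close>

lemma pullback_inequality:
  assumes fin: "finite Y" and nn: "\<And>q s. q \<in> set (p # ps) \<Longrightarrow> q s \<ge> 0"
  shows "form (p # ps) Y v v \<le> (\<Sum>i\<in>ends Y. p (fst i) * form ps (Y \<ominus> i) (inherit Y i v) (inherit Y i v))"
proof -
  let ?E = "ends Y" and ?p = "\<lambda>i. p (fst i)"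
  \<comment> \<open>\<open>C i j\<close> comes from removing first \<open>i\<close> and then
    \<open>j\<close>; \<open>W i j\<close> weighs the ends freed only when both are gone.\<close>
  define C where "C i j = row ps (Y \<ominus> i) (inherit Y i v) j" for i j
  define new where "new i = ends (Y \<ominus> i) - ?E" for i
  define W where "W i j = (\<Sum>k\<in>{k \<in> ends (Y \<ominus> i \<ominus> j). k \<notin> ends (Y \<ominus> i) \<and> k \<notin> ends (Y \<ominus> j)}.
      wgt ps (Y \<ominus> i \<ominus> j \<ominus> k))" for i j
  have finE: "finite ?E" using fin by (rule finite_ends)
  \<comment> \<open>An end freed only by both removals inherits from the one removed last:
    \<open>v j\<close> in \<open>C i j\<close>, \<open>v i\<close> in \<open>C j i\<close>. All
    other ends receive the same value in both orders.\<close>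
  have comm: "C i j - C j i = W i j * (v j - v i)"
    if ij: "i \<in> ?E" "j \<in> ?E" "snd i \<noteq> snd j" for i j
  proof -
    have "C i j - C j i = (\<Sum>k\<in>ends (Y \<ominus> i \<ominus> j). wgt ps (Y \<ominus> i \<ominus> j \<ominus> k) *
        (inherit (Y \<ominus> i) j (inherit Y i v) k - inherit (Y \<ominus> j) i (inherit Y j v) k))"
      unfolding C_def row_def
      by (simp add: remove_end_commute[of Y j i] sum_subtractf algebra_simps)
    also have "\<dots> = (\<Sum>k\<in>ends (Y \<ominus> i \<ominus> j). if k \<notin> ends (Y \<ominus> i) \<and> k \<notin> ends (Y \<ominus> j)
        then wgt ps (Y \<ominus> i \<ominus> j \<ominus> k) * (v j - v i) else 0)"
    proof (intro sum.cong refl)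
      fix k assume k: "k \<in> ends (Y \<ominus> i \<ominus> j)"
      have "k \<in> ends (Y \<ominus> i)" "k \<in> ends (Y \<ominus> j)" if "k \<in> ?E"
        using that ends_mem[OF k] by (auto intro!: ends_remove_end)
      moreover have "\<not> (k \<in> ends (Y \<ominus> i) \<and> k \<in> ends (Y \<ominus> j))" if "k \<notin> ?E"
        using that ends_two_removals[OF ij(3)] by blast
      ultimately show "wgt ps (Y \<ominus> i \<ominus> j \<ominus> k) *
          (inherit (Y \<ominus> i) j (inherit Y i v) k - inherit (Y \<ominus> j) i (inherit Y j v) k) =
          (if k \<notin> ends (Y \<ominus> i) \<and> k \<notin> ends (Y \<ominus> j)
           then wgt ps (Y \<ominus> i \<ominus> j \<ominus> k) * (v j - v i) else 0)"
        using ij by (auto simp: inherit_def)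
    qed
    also have "\<dots> = W i j * (v j - v i)"
      unfolding W_def sum_distrib_right using fin
      by (intro sum.mono_neutral_cong_right) (auto intro: finite_ends)
    finally show ?thesis .
  qed
  have Wsym: "W i j = W j i" for i j
    unfolding W_def remove_end_commute[of Y j i] by (intro sum.cong) auto
  have Wnn: "W i j \<ge> 0" for i j
    unfolding W_def using nn by (intro sum_nonneg wgt_nonneg) auto
  \<comment> \<open>An end counted in \<open>W i j\<close> lies on the side of \<open>i\<close> and
    on the side of \<open>j\<close>, so the two values of \<open>p\<close> agree.\<close>
  have Wp: "W i j = 0 \<or> ?p i = ?p j" if ij: "i \<in> ?E" "j \<in> ?E" "snd i \<noteq> snd j" for i j
  proof (cases "\<exists>k\<in>ends (Y \<ominus> i \<ominus> j). k \<notin> ends (Y \<ominus> i) \<and> k \<notin> ends (Y \<ominus> j)")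
    case True
    then obtain k where k: "k \<in> ends (Y \<ominus> i \<ominus> j)" "k \<notin> ends (Y \<ominus> i)" "k \<notin> ends (Y \<ominus> j)" by blast
    have "j \<in> ends (Y \<ominus> i)" "i \<in> ends (Y \<ominus> j)" using ij by (auto intro: ends_remove_end)
    then have "fst k = fst j" "fst k = fst i"
      using new_end_same_side[of j "Y \<ominus> i" k] new_end_same_side[of i "Y \<ominus> j" k] k
      by (auto simp: remove_end_commute[of Y i j])
    then show ?thesis by simp
  next
    case False
    then have "{k \<in> ends (Y \<ominus> i \<ominus> j). k \<notin> ends (Y \<ominus> i) \<and> k \<notin> ends (Y \<ominus> j)} = {}" by blast
    then show ?thesis unfolding W_def by (simp only: sum.empty simp_thms)
  qed
  have "(\<Sum>i\<in>?E. ?p i * form ps (Y \<ominus> i) (inherit Y i v) (inherit Y i v)) =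
      (\<Sum>i\<in>?E. \<Sum>j\<in>ends (Y \<ominus> i). ?p i * inherit Y i v j * C i j)"
    using fin by (simp add: form_eq C_def sum_distrib_left mult.assoc)
  also have "\<dots> = (\<Sum>i\<in>?E. (\<Sum>j\<in>{j\<in>?E. snd j \<noteq> snd i}. ?p i * v j * C i j) + (\<Sum>j\<in>new i. ?p i * v i * C i j))"
    using fin by (auto intro!: sum.cong arg_cong2[where f = "(+)"] simp: ends_split inherit_def new_def)
  finally have lhs: "(\<Sum>i\<in>?E. ?p i * form ps (Y \<ominus> i) (inherit Y i v) (inherit Y i v)) =
    (\<Sum>i\<in>?E. \<Sum>j\<in>{j\<in>?E. snd j \<noteq> snd i}. ?p i * v j * C i j) + (\<Sum>i\<in>?E. \<Sum>j\<in>new i. ?p i * v i * C i j)"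
    by (simp add: sum.distrib)
  have "form (p # ps) Y v v = (\<Sum>j\<in>?E. v j * form ps (Y \<ominus> j) ?p (inherit Y j v))"
    using fin by (simp add: form_eq[of Y] row_Cons)
  also have "\<dots> = (\<Sum>j\<in>?E. \<Sum>i\<in>ends (Y \<ominus> j). ?p i * v j * C j i)"
    using fin by (simp add: form_eq C_def sum_distrib_left mult.assoc mult.left_commute)
  also have "\<dots> = (\<Sum>j\<in>?E. (\<Sum>i\<in>{i\<in>?E. snd i \<noteq> snd j}. ?p i * v j * C j i) + (\<Sum>i\<in>new j. ?p j * v j * C j i))"
    using fin by (auto intro!: sum.cong arg_cong2[where f = "(+)"] simp: ends_split new_def dest: new_end_same_side)
  finally have rhs: "form (p # ps) Y v v =
    (\<Sum>j\<in>?E. \<Sum>i\<in>{i\<in>?E. snd i \<noteq> snd j}. ?p i * v j * C j i) + (\<Sum>i\<in>?E. \<Sum>j\<in>new i. ?p i * v i * C i j)"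
    by (simp add: sum.distrib)
  have filt: "(\<Sum>j\<in>{j\<in>?E. snd j \<noteq> snd i}. f j) = (\<Sum>j\<in>?E. if snd j \<noteq> snd i then f j else 0)" for f :: "_ \<Rightarrow> real" and i
    using finE by (simp add: sum.inter_filter)
  have "(\<Sum>j\<in>?E. \<Sum>i\<in>{i\<in>?E. snd i \<noteq> snd j}. ?p i * v j * C j i) =
      (\<Sum>i\<in>?E. \<Sum>j\<in>{j\<in>?E. snd j \<noteq> snd i}. ?p i * v j * C j i)"
    unfolding filt by (subst sum.swap) (intro sum.cong refl, auto)
  \<comment> \<open>The terms over new ends coincide in \<open>lhs\<close> and \<open>rhs\<close>;
    only pairs of old ends remain, with the commutator of \<open>C\<close>.\<close>
  then have "(\<Sum>i\<in>?E. ?p i * form ps (Y \<ominus> i) (inherit Y i v) (inherit Y i v)) - form (p # ps) Y v v =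
      (\<Sum>i\<in>?E. \<Sum>j\<in>{j\<in>?E. snd j \<noteq> snd i}. ?p i * v j * (C i j - C j i))"
    unfolding lhs rhs by (simp add: sum_subtractf algebra_simps)
  also have "\<dots> = (\<Sum>i\<in>?E. \<Sum>j\<in>?E. if snd j \<noteq> snd i then ?p i * v j * (W i j * (v j - v i)) else 0)"
    unfolding filt by (intro sum.cong refl if_cong) (auto simp: comm)
  also have "\<dots> \<ge> 0"
  proof (rule sum_symmetrize)
    fix i j assume ij: "i \<in> ?E" "j \<in> ?E"
    show "(if snd j \<noteq> snd i then ?p i * v j * (W i j * (v j - v i)) else 0) +
        (if snd i \<noteq> snd j then ?p j * v i * (W j i * (v i - v j)) else 0) \<ge> 0"
    proof (cases "snd i = snd j \<or> W i j = 0")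
      case True then show ?thesis using Wsym[of i j] by auto
    next
      case False
      then have "?p i = ?p j" using Wp[OF ij] by blast
      then have "?p i * v j * (W i j * (v j - v i)) + ?p j * v i * (W j i * (v i - v j)) =
          ?p i * W i j * (v j - v i)\<^sup>2"
        using Wsym[of i j] by (simp add: power2_eq_square algebra_simps)
      also have "\<dots> \<ge> 0" using Wnn nn by simp
      finally show ?thesis using False by (simp add: eq_commute[of "snd j"])
    qed
  qed
  finally show ?thesis by simp
qed

text \<open>Two elements besides \<open>z\<close> remain. If they are comparable there are at most
  two ends and a two by two determinant decides; if not, removals free nothing and the form is a
  symmetrised product of two linear functionals.\<close>

lemma hyperbolic_form_base:
  assumes fin: "finite Y" and z: "z \<in> Y" and card: "card Y = 3"
  shows "hyperbolic (form [] Y)"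
proof -
  have "card (Y - {z}) = 2" using fin z card by simp
  then obtain x y where xy: "Y - {z} = {x, y}" "x \<noteq> y" by (auto simp: card_2_iff)
  have Y: "Y = {x, y, z}" and ne: "x \<noteq> z" "y \<noteq> z" using xy z by auto
  have chain: "hyperbolic (form [] {x, y, z})" if xy: "x \<sqsubset> y" and ne: "x \<noteq> z" "y \<noteq> z" for x y
  proof -
    have nxy: "x \<noteq> y" "\<not> y \<sqsubset> x" using xy lt_irrefl lt_trans by blast+
    \<comment> \<open>The entries of the form on the ends \<open>?P\<close> and \<open>?Q\<close>,
      set to 0 where an end is missing.\<close>
    define \<alpha> \<beta> \<gamma> :: real where "\<alpha> = of_bool (\<not> z \<sqsubset> x \<and> \<not> z \<sqsubset> y)"
      and "\<beta> = of_bool (\<not> y \<sqsubset> z \<and> \<not> x \<sqsubset> z)" and "\<gamma> = of_bool (\<not> z \<sqsubset> x \<and> \<not> y \<sqsubset> z)"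
    let ?P = "(True, x)" and ?Q = "(False, y)"
    have E: "ends {x, y, z} = (if z \<sqsubset> x then {} else {?P}) \<union> (if y \<sqsubset> z then {} else {?Q})"
      using xy ne nxy lt_irrefl by (auto simp: ends_def split: if_splits)
    have yz: "{x, y, z} - {x} = {y, z}" and xz: "{x, y, z} - {y} = {x, z}" using nxy ne by auto
    have newP: "ends {y, z} - ends {x, y, z} = (if z \<sqsubset> y then {} else {(True, y)})"
      unfolding E using xy ne nxy lt_irrefl by (auto simp: ends_def split: if_splits)
    have newQ: "ends {x, z} - ends {x, y, z} = (if x \<sqsubset> z then {} else {(False, x)})"
      unfolding E using xy ne nxy lt_irrefl by (auto simp: ends_def split: if_splits)
    have f: "form [] {x, y, z} u v = \<alpha> * u ?P * v ?P + \<beta> * u ?Q * v ?Q + \<gamma> * (u ?P * v ?Q + u ?Q * v ?P)" for u v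
    proof -
      have m: "mat [] {x,y,z} ?P ?P = of_bool (\<not> z \<sqsubset> y)" "mat [] {x,y,z} ?Q ?Q = of_bool (\<not> x \<sqsubset> z)"
        "mat [] {x,y,z} ?P ?Q = 1" "mat [] {x,y,z} ?Q ?P = 1"
        using nxy by (simp_all add: mat_def yz xz newP newQ)
      show ?thesis
        unfolding bform_def E \<alpha>_def \<beta>_def \<gamma>_def by (auto simp: m algebra_simps)
    qed
    have "\<alpha> * \<beta> \<le> \<gamma>\<^sup>2" by (simp add: \<alpha>_def \<beta>_def \<gamma>_def)
    then have "0 \<le> (\<gamma>\<^sup>2 - \<alpha> * \<beta>) * (u ?P * v ?Q - u ?Q * v ?P)\<^sup>2" for u v by simp
    moreover have "(form [] {x, y, z} u v)\<^sup>2 - form [] {x, y, z} u u * form [] {x, y, z} v v =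
        (\<gamma>\<^sup>2 - \<alpha> * \<beta>) * (u ?P * v ?Q - u ?Q * v ?P)\<^sup>2" for u v
      unfolding f by algebra
    ultimately show ?thesis unfolding hyperbolic_def by (metis diff_ge_0_iff_ge)
  qed
  consider "x \<sqsubset> y" | "y \<sqsubset> x" | "\<not> x \<sqsubset> y" "\<not> y \<sqsubset> x" by blast
  then show ?thesis
  proof cases
    case 1 then show ?thesis using chain ne Y by blast
  next
    case 2
    then show ?thesis using chain[of y x] ne Y by (simp add: insert_commute)
  next
    case 3
    let ?E = "ends Y"
    have finE: "finite ?E" using fin by (rule finite_ends)
    define f where "f w u = (\<Sum>i\<in>{i\<in>?E. snd i = w}. u i :: real)" for w u
    have el: "snd i = x \<or> snd i = y" if "i \<in> ?E" for i using ends_mem[OF that] Y by auto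
    have new: "ends (Y \<ominus> i) - ?E = {}" if "i \<in> ?E" for i
    proof -
      have "j \<in> ends Y" if j: "j \<in> ends (Y \<ominus> i)" for j
      proof -
        have "snd j \<noteq> z" "snd j \<in> Y" "snd j \<noteq> snd i" using ends_mem[OF j] by auto
        then have "\<not> snd i \<sqsubset> snd j" "\<not> snd j \<sqsubset> snd i"
          using el[OF \<open>i \<in> ?E\<close>] 3 Y by auto
        then show ?thesis using j by (auto simp: ends_def split: if_splits)
      qed
      then show ?thesis by blast
    qed
    have m: "mat [] Y i j = of_bool (snd i \<noteq> snd j)" if "i \<in> ?E" for i j
      unfolding mat_def new[OF that] by simp
    have s: "sum g ?E = (\<Sum>i\<in>{i\<in>?E. snd i = x}. g i) + (\<Sum>i\<in>{i\<in>?E. snd i = y}. g i)" for g :: "_ \<Rightarrow> real"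
    proof -
      have "?E = {i\<in>?E. snd i = x} \<union> {i\<in>?E. snd i = y}" using el by blast
      then have "sum g ?E = sum g ({i\<in>?E. snd i = x} \<union> {i\<in>?E. snd i = y})" by simp
      also have "\<dots> = (\<Sum>i\<in>{i\<in>?E. snd i = x}. g i) + (\<Sum>i\<in>{i\<in>?E. snd i = y}. g i)"
        using finE xy(2) by (intro sum.union_disjoint) auto
      finally show ?thesis .
    qed
    have r: "(\<Sum>j\<in>?E. mat [] Y i j * v j) = (if snd i = x then f y v else f x v)" if "i \<in> ?E" for i v
      using el[OF that] xy(2) unfolding s f_def by (auto simp: m[OF that] intro: sum.cong)
    have B: "form [] Y u v = f x u * f y v + f y u * f x v" for u v
    proof -
      have "form [] Y u v = (\<Sum>i\<in>?E. u i * (if snd i = x then f y v else f x v))"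
        unfolding bform_def by (simp add: r)
      also have "\<dots> = f x u * f y v + f y u * f x v"
        unfolding s using xy(2) by (simp add: f_def sum_distrib_right)
      finally show ?thesis .
    qed
    have "(form [] Y u v)\<^sup>2 - form [] Y u u * form [] Y v v = (f x u * f y v - f y u * f x v)\<^sup>2" for u v
      unfolding B by algebra
    then show ?thesis unfolding hyperbolic_def by (metis diff_ge_0_iff_ge zero_le_power2)
  qed
qed

text \<open>Induction, with \<open>h\<close> the side vector of the first body \<open>p\<close>. The
  contraction hypothesis follows from \<open>pullback_inequality\<close>, each form on
  \<open>Y \<ominus> i\<close> being bounded by the square of a row through its
  hyperbolicity.\<close>

lemma hyperbolic_form:
  assumes "finite Y" "z \<in> Y" "card Y = length ps + 3" "\<And>p s. p \<in> set ps \<Longrightarrow> p s > 0"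
  shows "hyperbolic (form ps Y)"
  using assms
proof (induction ps arbitrary: Y)
  case Nil
  then show ?case by (simp add: hyperbolic_form_base)
next
  case (Cons p ps)
  let ?E = "ends Y" and ?p = "\<lambda>i. p (fst i)"
  have fin: "finite Y" and z: "z \<in> Y" by fact+
  have pos: "q s > 0" if "q \<in> set (p # p # ps)" for q s using Cons.prems(4) that by auto
  have rem: "z \<in> Y \<ominus> i" "card (Y \<ominus> i) = length ps + 3" "finite (Y \<ominus> i)" if "i \<in> ?E" for i
    using ends_mem[OF that] Cons.prems by auto
  \<comment> \<open>These are the row sums against \<open>h\<close> by \<open>row_side\<close>;
    \<open>p\<close> occurs once as a body and once as the test vector.\<close>
  define b where "b i = wgt (p # p # ps) (Y \<ominus> i)" for i
  have bpos: "b i > 0" if "i \<in> ?E" for i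
    unfolding b_def using rem[OF that] pos by (intro wgt_pos) auto
  have brow: "b i = row (p # ps) Y ?p i" if "i \<in> ?E" for i
    using row_side[OF that, of "p # ps" p] by (simp add: b_def)
  have matpos: "mat (p # ps) Y i j > 0" if "i \<in> ?E" "j \<in> ?E" "snd i \<noteq> snd j" for i j
  proof -
    have "wgt (p # ps) (Y \<ominus> i \<ominus> j) > 0"
      using that ends_mem[OF that(1)] ends_mem[OF that(2)] rem[OF that(1)] pos by (intro wgt_pos) auto
    then show ?thesis using that(3) by (simp add: mat_def)
  qed
  show ?case
  proof (rule hyperbolic_of_contraction[where h = ?p and b = b])
    show "finite ?E" using fin by (rule finite_ends)
    show "mat (p # ps) Y i j = mat (p # ps) Y j i" for i j by (rule mat_sym)
    show "mat (p # ps) Y i j \<ge> 0" for i j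
      unfolding mat_def using pos by (auto intro!: sum_nonneg wgt_nonneg simp: less_imp_le simp del: wgt.simps)
    show "?p i > 0" for i using pos by simp
    show "b i = (\<Sum>j\<in>?E. mat (p # ps) Y i j * ?p j)" "b i > 0" if "i \<in> ?E" for i
      using that bpos brow row_eq_mat[OF fin] by auto
    show "mat (p # ps) Y i j > 0 \<or> (\<exists>k\<in>?E. mat (p # ps) Y i k > 0 \<and> mat (p # ps) Y k j > 0)"
      if ij: "i \<in> ?E" "j \<in> ?E" "i \<noteq> j" for i j
    proof (cases "snd i = snd j")
      case False then show ?thesis using matpos ij by blast
    next
      case True
      \<comment> \<open>The minimal and the maximal end at one element are joined through a third
        end. It is an old one, since a new one would lie on both sides at once.\<close>
      have "ends (Y \<ominus> i) \<noteq> {}" using rem[OF ij(1)] by (intro ends_nonempty) auto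
      then obtain k where k: "k \<in> ends (Y \<ominus> i)" by blast
      have "k \<in> ?E"
      proof (rule ccontr)
        assume k': "k \<notin> ?E"
        have "k \<in> ends (Y \<ominus> j)" using k True by simp
        then have "fst k = fst i" "fst k = fst j"
          using new_end_same_side k k' ij by blast+
        then show False using True ij(3) by (simp add: prod_eq_iff)
      qed
      moreover have "snd k \<noteq> snd i" using ends_mem[OF k] by auto
      ultimately have "mat (p # ps) Y i k > 0 \<and> mat (p # ps) Y k j > 0"
        using matpos ij True by metis
      then show ?thesis using \<open>k \<in> ?E\<close> by blast
    qed
    show "form (p # ps) Y v v \<le> (\<Sum>i\<in>?E. ?p i * (\<Sum>j\<in>?E. mat (p # ps) Y i j * v j)\<^sup>2 / b i)" for v
    proof -
      have "form (p # ps) Y v v \<le> (\<Sum>i\<in>?E. ?p i * form ps (Y \<ominus> i) (inherit Y i v) (inherit Y i v))"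
        using pos by (intro pullback_inequality fin) (auto simp: less_imp_le)
      also have "\<dots> \<le> (\<Sum>i\<in>?E. ?p i * ((\<Sum>j\<in>?E. mat (p # ps) Y i j * v j)\<^sup>2 / b i))"
      proof (intro sum_mono mult_left_mono)
        fix i assume i: "i \<in> ?E"
        have hyp: "hyperbolic (form ps (Y \<ominus> i))"
          using rem[OF i] Cons.prems(4) by (intro Cons.IH) auto
        have e: "inherit Y i ?p j = ?p j" if "j \<in> ends (Y \<ominus> i)" for j using inherit_side[OF i that] .
        have "form ps (Y \<ominus> i) ?p (inherit Y i ?p) = form ps (Y \<ominus> i) ?p ?p"
          unfolding bform_def by (intro sum.cong refl) (simp add: e)
        then have bf: "b i = form ps (Y \<ominus> i) ?p ?p"
          using brow[OF i] row_Cons[OF fin i] by simp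
        \<comment> \<open>Reversed Cauchy-Schwarz on the smaller poset; its mixed value is the row
          by \<open>row_Cons\<close>.\<close>
        have "form ps (Y \<ominus> i) ?p ?p * form ps (Y \<ominus> i) (inherit Y i v) (inherit Y i v) \<le> (form ps (Y \<ominus> i) ?p (inherit Y i v))\<^sup>2"
          using hyp bpos[OF i] bf unfolding hyperbolic_def by metis
        then have "b i * form ps (Y \<ominus> i) (inherit Y i v) (inherit Y i v) \<le> (\<Sum>j\<in>?E. mat (p # ps) Y i j * v j)\<^sup>2"
          using bf row_Cons[OF fin i] row_eq_mat[OF fin i] by simp
        then show "form ps (Y \<ominus> i) (inherit Y i v) (inherit Y i v) \<le> (\<Sum>j\<in>?E. mat (p # ps) Y i j * v j)\<^sup>2 / b i"
          using bpos[OF i] by (simp add: pos_le_divide_eq mult.commute)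
        show "?p i \<ge> 0" using pos[of p] by (simp add: less_imp_le)
      qed
      finally show ?thesis by simp
    qed
  qed
qed

section \<open>Counting linear extensions by the position of an element\<close>

text \<open>Linear extensions as words, so that moving an element is a rearrangement of a
  list.\<close>

definition linexts :: "'a set \<Rightarrow> 'a list set" where
  "linexts Y = {w. distinct w \<and> set w = Y \<and> sorted_wrt (\<lambda>x y. \<not> y \<sqsubset> x) w}"

definition zlin :: "'a set \<Rightarrow> nat \<Rightarrow> 'a list set" where
  "zlin Y b = {w \<in> linexts Y. \<exists>\<alpha> \<beta>. w = \<alpha> @ z # \<beta> \<and> length \<beta> = b}"

definition cnt :: "'a set \<Rightarrow> nat \<Rightarrow> nat" where
  "cnt Y b = card (zlin Y b)"

lemma zlinI: "\<alpha> @ z # \<beta> \<in> linexts Y \<Longrightarrow> length \<beta> = b \<Longrightarrow> \<alpha> @ z # \<beta> \<in> zlin Y b"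
  unfolding zlin_def by blast

lemma linexts_length: "w \<in> linexts Y \<Longrightarrow> length w = card Y"
  by (auto simp: linexts_def distinct_card)

lemma finite_linexts: "finite Y \<Longrightarrow> finite (linexts Y)"
  by (rule finite_subset[OF _ finite_lists_length_eq[of Y "card Y"]])
    (auto simp: linexts_def distinct_card)

lemma finite_zlin: "finite Y \<Longrightarrow> finite (zlin Y b)"
  by (rule finite_subset[OF _ finite_linexts]) (auto simp: zlin_def)

lemma Cons_linexts:
  "x # w \<in> linexts Y \<longleftrightarrow> x \<in> Y \<and> (\<forall>y\<in>Y. \<not> y \<sqsubset> x) \<and> w \<in> linexts (Y - {x})"
  using lt_irrefl by (auto simp: linexts_def)

lemma snoc_linexts:
  "w @ [x] \<in> linexts Y \<longleftrightarrow> x \<in> Y \<and> (\<forall>y\<in>Y. \<not> x \<sqsubset> y) \<and> w \<in> linexts (Y - {x})"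
  using lt_irrefl by (auto simp: linexts_def sorted_wrt_append)

text \<open>The bound on \<open>b\<close> leaves an element in front of \<open>z\<close>, so the
  first letter is a minimal element other than \<open>z\<close>.\<close>

lemma zlin_lower:
  assumes "b + 2 \<le> card Y"
  shows "zlin Y b = (\<Union>i\<in>{i \<in> ends Y. fst i}. (#) (snd i) ` zlin (Y \<ominus> i) b)"
proof (intro subset_antisym subsetI)
  fix w assume w: "w \<in> zlin Y b"
  then obtain \<alpha> \<beta> where ab: "w = \<alpha> @ z # \<beta>" "length \<beta> = b" by (auto simp: zlin_def)
  have "length w = card Y" using w by (auto simp: zlin_def linexts_length)
  then obtain x \<alpha>' where a: "\<alpha> = x # \<alpha>'" using ab assms by (cases \<alpha>) auto
  have *: "x # (\<alpha>' @ z # \<beta>) \<in> linexts Y" using w ab a by (auto simp: zlin_def)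
  then have "x \<noteq> z" by (auto simp: linexts_def)
  then have "(True, x) \<in> ends Y" "\<alpha>' @ z # \<beta> \<in> zlin (Y - {x}) b"
    using * ab unfolding Cons_linexts by (auto simp: ends_def zlin_def)
  then show "w \<in> (\<Union>i\<in>{i \<in> ends Y. fst i}. (#) (snd i) ` zlin (Y \<ominus> i) b)"
    using ab a by force
next
  fix w assume "w \<in> (\<Union>i\<in>{i \<in> ends Y. fst i}. (#) (snd i) ` zlin (Y \<ominus> i) b)"
  then obtain x \<alpha> \<beta> where x: "(True, x) \<in> ends Y" "w = x # \<alpha> @ z # \<beta>" "length \<beta> = b"
    "\<alpha> @ z # \<beta> \<in> linexts (Y - {x})"
    by (auto simp: zlin_def)
  then have "w \<in> linexts Y" by (auto simp: Cons_linexts ends_def)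
  moreover have "w = (x # \<alpha>) @ z # \<beta>" using x by simp
  ultimately show "w \<in> zlin Y b" using x unfolding zlin_def by blast
qed

lemma zlin_upper:
  "zlin Y (Suc b) = (\<Union>i\<in>{i \<in> ends Y. \<not> fst i}. (\<lambda>w. w @ [snd i]) ` zlin (Y \<ominus> i) b)"
proof (intro subset_antisym subsetI)
  fix w assume w: "w \<in> zlin Y (Suc b)"
  then obtain \<alpha> \<beta> where ab: "w = \<alpha> @ z # \<beta>" "length \<beta> = Suc b" by (auto simp: zlin_def)
  then obtain x \<beta>' where a: "\<beta> = \<beta>' @ [x]" by (cases \<beta> rule: rev_cases) auto
  have *: "(\<alpha> @ z # \<beta>') @ [x] \<in> linexts Y" using w ab a by (auto simp: zlin_def)
  then have "x \<noteq> z" by (auto simp: linexts_def)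
  then have "(False, x) \<in> ends Y" "\<alpha> @ z # \<beta>' \<in> zlin (Y - {x}) b"
    using * ab a unfolding snoc_linexts by (auto simp: ends_def zlin_def)
  then show "w \<in> (\<Union>i\<in>{i \<in> ends Y. \<not> fst i}. (\<lambda>w. w @ [snd i]) ` zlin (Y \<ominus> i) b)"
    using ab a by force
next
  fix w assume "w \<in> (\<Union>i\<in>{i \<in> ends Y. \<not> fst i}. (\<lambda>w. w @ [snd i]) ` zlin (Y \<ominus> i) b)"
  then obtain x \<alpha> \<beta> where x: "(False, x) \<in> ends Y" "w = (\<alpha> @ z # \<beta>) @ [x]" "length \<beta> = b"
    "\<alpha> @ z # \<beta> \<in> linexts (Y - {x})"
    by (auto simp: zlin_def)
  then have "w \<in> linexts Y" unfolding x(2) snoc_linexts by (auto simp: ends_def)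
  moreover have "w = \<alpha> @ z # (\<beta> @ [x])" "length (\<beta> @ [x]) = Suc b" using x by simp_all
  ultimately show "w \<in> zlin Y (Suc b)" unfolding zlin_def by blast
qed

lemma cnt_lower:
  assumes "finite Y" "b + 2 \<le> card Y"
  shows "cnt Y b = (\<Sum>i\<in>{i \<in> ends Y. fst i}. cnt (Y \<ominus> i) b)"
  unfolding cnt_def zlin_lower[OF assms(2)] using assms
  by (intro card_disjoint_images) (auto simp: finite_ends finite_zlin)

lemma cnt_upper:
  assumes "finite Y"
  shows "cnt Y (Suc b) = (\<Sum>i\<in>{i \<in> ends Y. \<not> fst i}. cnt (Y \<ominus> i) b)"
  unfolding cnt_def zlin_upper using assms
  by (intro card_disjoint_images) (auto simp: finite_ends finite_zlin inj_on_def)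

section \<open>From weights to numbers of linear extensions\<close>

lemma cnt_singleton: "cnt {z} 0 = 1"
proof -
  have "zlin {z} 0 = {[z]}"
  proof (intro subset_antisym subsetI)
    fix w assume w: "w \<in> zlin {z} 0"
    then have "length w = 1" by (auto simp: zlin_def dest: linexts_length)
    then show "w \<in> {[z]}" using w by (auto simp: zlin_def)
  next
    fix w assume "w \<in> {[z]}"
    then show "w \<in> zlin {z} 0" by (auto simp: zlin_def linexts_def)
  qed
  then show ?thesis by (simp add: cnt_def)
qed

text \<open>At \<open>e = 0\<close> this body permits removals on the side \<open>s\<close> only;
  \<open>e > 0\<close> makes its values positive.\<close>

definition sel :: "real \<Rightarrow> bool \<Rightarrow> bool \<Rightarrow> real" where
  "sel e s t = (if s = t then 1 else e)"

text \<open>The list prescribes from which end to strip the word, \<open>False\<close> stripping a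
  letter after \<open>z\<close>; whatever the order, each word is counted once.\<close>

lemma wgt_sel_eq_cnt:
  assumes "finite Y" "z \<in> Y" "card Y = length bs + 1"
  shows "wgt (map (sel 0) bs) Y = real (cnt Y (length (filter Not bs)))"
  using assms
proof (induction bs arbitrary: Y)
  case Nil
  then have "Y = {z}" by (auto simp: card_Suc_eq)
  then show ?case by (simp add: cnt_singleton)
next
  case (Cons s bs)
  let ?c = "length (filter Not bs)"
  have IH: "wgt (map (sel 0) bs) (Y \<ominus> i) = real (cnt (Y \<ominus> i) ?c)" if "i \<in> ends Y" for i
    using Cons.prems ends_mem[OF that] by (intro Cons.IH) auto
  have "wgt (map (sel 0) (s # bs)) Y = (\<Sum>i\<in>ends Y. if s = fst i then real (cnt (Y \<ominus> i) ?c) else 0)"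
    by (auto intro!: sum.cong simp: sel_def IH)
  also have "\<dots> = real (\<Sum>i\<in>{i \<in> ends Y. s = fst i}. cnt (Y \<ominus> i) ?c)"
    using Cons.prems by (simp add: sum.inter_filter finite_ends if_distrib[of real] cong: if_cong)
  also have "\<dots> = real (cnt Y (length (filter Not (s # bs))))"
  proof (cases s)
    case True
    have "?c \<le> length bs" by simp
    then have "?c + 2 \<le> card Y" using Cons.prems by simp
    then show ?thesis using True cnt_lower[of Y ?c] Cons.prems by simp
  next
    case False
    then show ?thesis using cnt_upper[of Y ?c] Cons.prems by simp
  qed
  finally show ?case .
qed

lemma form_side:
  assumes "finite Y"
  shows "form ps Y (\<lambda>i. p (fst i)) (\<lambda>i. q (fst i)) = wgt (p # q # ps) Y"
  unfolding form_eq[OF assms] by (simp add: row_side cong: sum.cong)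

text \<open>The unit vector extracts one row, thereby replacing \<open>Y\<close> by
  \<open>Y \<ominus> m\<close>.\<close>

lemma form_unit_side:
  assumes "finite Y" "m \<in> ends Y"
  shows "form ps Y (\<lambda>i. of_bool (i = m)) (\<lambda>i. q (fst i)) = wgt (q # ps) (Y \<ominus> m)"
proof -
  have "form ps Y (\<lambda>i. of_bool (i = m)) (\<lambda>i. q (fst i)) =
      (\<Sum>i\<in>ends Y. if i = m then row ps Y (\<lambda>i. q (fst i)) i else 0)"
    unfolding form_eq[OF assms(1)] by (intro sum.cong) auto
  also have "\<dots> = row ps Y (\<lambda>i. q (fst i)) m"
    using assms by (simp add: finite_ends)
  finally show ?thesis using row_side[OF assms(2)] by simp
qed

lemma tendsto_wgt_sel: "((\<lambda>e. wgt (map (sel e) bs) Y) \<longlongrightarrow> wgt (map (sel 0) bs) Y) (at_right 0)"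
proof (induction bs arbitrary: Y)
  case (Cons s bs)
  have "((\<lambda>e. sel e s t) \<longlongrightarrow> sel 0 s t) (at_right 0)" for t
    unfolding sel_def by (cases "s = t") (auto intro: tendsto_eq_intros)
  then show ?case using Cons.IH by (auto intro!: tendsto_intros)
qed simp

lemma tendsto_form_sel:
  assumes "\<And>i. ((\<lambda>e. u e i) \<longlongrightarrow> u' i) (at_right 0)" "\<And>i. ((\<lambda>e. v e i) \<longlongrightarrow> v' i) (at_right 0)"
  shows "((\<lambda>e. form (map (sel e) bs) Y (u e) (v e)) \<longlongrightarrow> form (map (sel 0) bs) Y u' v') (at_right 0)"
proof -
  have "((\<lambda>e. mat (map (sel e) bs) Y i j) \<longlongrightarrow> mat (map (sel 0) bs) Y i j) (at_right 0)" for i j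
    unfolding mat_def by (auto intro!: tendsto_intros tendsto_wgt_sel)
  then show ?thesis unfolding bform_def by (intro tendsto_intros assms)
qed

text \<open>Positivity of the weights fails for the 0/1 weights that count linear extensions, hence the
  perturbation by \<open>e\<close> and the limit \<open>e \<rightarrow> 0\<close>. The inequality is hyperbolicity applied to the unit vector of \<open>m\<close>
  and the combination of the two side vectors orthogonal to it.\<close>

lemma cnt_cross_inequality:
  assumes fin: "finite Y" and z: "z \<in> Y" and m: "(False, m) \<in> ends Y" and card: "b + 3 \<le> card Y"
  shows "(cnt (Y - {m}) (b + 1))\<^sup>2 * cnt Y b + (cnt (Y - {m}) b)\<^sup>2 * cnt Y (b + 2)
      \<le> 2 * cnt (Y - {m}) b * cnt (Y - {m}) (b + 1) * cnt Y (b + 1)"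
proof -
  \<comment> \<open>This leaves two removals to the test vectors: two minimal ones give
    \<open>b\<close> elements after \<open>z\<close>, one of each kind \<open>b + 1\<close>, two
    maximal ones \<open>b + 2\<close>.\<close>
  define bs where "bs = replicate (card Y - b - 3) True @ replicate b False"
  have len: "card Y = length bs + 3" and ups: "length (filter Not bs) = b"
    using card by (simp_all add: bs_def)
  have zm: "m \<in> Y" "z \<noteq> m" using ends_mem[OF m] by auto
  define B where "B e = form (map (sel e) bs) Y" for e
  define A where "A = (\<lambda>i :: bool \<times> 'a. sel 0 True (fst i))"
  define C where "C = (\<lambda>i :: bool \<times> 'a. sel 0 False (fst i))"
  \<comment> \<open>The multiple of the all-ones vector makes \<open>B e (d e) (d e)\<close>
    positive and disappears in the limit.\<close>
  define d where "d e = (\<lambda>i. of_bool (i = (False, m)) + e * (1 :: real))" for e :: real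
  have ev: "\<forall>\<^sub>F e in at_right 0. (B e (d e) C)\<^sup>2 * B e A A + (B e (d e) A)\<^sup>2 * B e C C
      \<le> 2 * B e (d e) A * B e (d e) C * B e A C"
  proof (rule eventually_at_rightI[of 0 1])
    fix e :: real assume "e \<in> {0<..<1}"
    then have e: "e > 0" by simp
    have pos: "p s > 0" if "p \<in> set (map (sel e) bs)" for p s
      using that e by (auto simp: sel_def)
    have matnn: "mat (map (sel e) bs) Y i j \<ge> 0" for i j
      unfolding mat_def using pos by (auto intro!: sum_nonneg wgt_nonneg simp: less_imp_le simp del: wgt.simps)
    have nn: "B e u v \<ge> 0" if "\<And>i. u i \<ge> 0" "\<And>i. v i \<ge> 0" for u v
      unfolding B_def bform_def using that matnn by (intro sum_nonneg mult_nonneg_nonneg)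
    have "B e (\<lambda>i. 1) (\<lambda>i. 1) = wgt ((\<lambda>_. 1) # (\<lambda>_. 1) # map (sel e) bs) Y"
      unfolding B_def using form_side[OF fin, of _ "\<lambda>_. 1" "\<lambda>_. 1"] by simp
    also have "\<dots> > 0" using pos fin z len by (intro wgt_pos) auto
    finally have "B e (\<lambda>i. 1) (\<lambda>i. 1) > 0" .
    then have "e * (e * B e (\<lambda>i. 1) (\<lambda>i. 1)) > 0" using e by simp
    moreover have "B e (\<lambda>i. of_bool (i = (False, m))) (\<lambda>i. of_bool (i = (False, m))) \<ge> 0"
      "e * B e (\<lambda>i. of_bool (i = (False, m))) (\<lambda>i. 1) \<ge> 0"
      "e * B e (\<lambda>i. 1) (\<lambda>i. of_bool (i = (False, m))) \<ge> 0"
      using e by (auto intro!: nn mult_nonneg_nonneg)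
    ultimately have "B e (d e) (d e) > 0"
      unfolding d_def B_def bform_add_left bform_add_right by (simp add: algebra_simps)
    then show "(B e (d e) C)\<^sup>2 * B e A A + (B e (d e) A)\<^sup>2 * B e C C
      \<le> 2 * B e (d e) A * B e (d e) C * B e A C"
      unfolding B_def using pos fin z len
      by (intro hyperbolic_orthogonal hyperbolic_form) (auto intro: mat_sym)
  qed simp
  have dl: "((\<lambda>e. d e i) \<longlongrightarrow> of_bool (i = (False, m))) (at_right 0)" for i
    unfolding d_def by (auto intro!: tendsto_eq_intros)
  let ?d = "\<lambda>i. of_bool (i = (False, m)) :: real"
  have lim: "(B 0 ?d C)\<^sup>2 * B 0 A A + (B 0 ?d A)\<^sup>2 * B 0 C C \<le> 2 * B 0 ?d A * B 0 ?d C * B 0 A C"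
    by (rule tendsto_le[OF _ _ _ ev]) (auto simp: B_def intro!: tendsto_intros tendsto_form_sel dl)
  have Y: "B 0 A A = cnt Y b" "B 0 A C = cnt Y (b + 1)" "B 0 C C = cnt Y (b + 2)"
    using wgt_sel_eq_cnt[of Y "True # True # bs"] wgt_sel_eq_cnt[of Y "True # False # bs"]
      wgt_sel_eq_cnt[of Y "False # False # bs"] fin z len ups
    unfolding B_def A_def C_def form_side[OF fin] by simp_all
  have Q: "B 0 ?d A = cnt (Y - {m}) b" "B 0 ?d C = cnt (Y - {m}) (b + 1)"
    using wgt_sel_eq_cnt[of "Y - {m}" "True # bs"] wgt_sel_eq_cnt[of "Y - {m}" "False # bs"] fin z len ups zm
    unfolding B_def A_def C_def form_unit_side[OF fin m] by simp_all
  have "real ((cnt (Y - {m}) (b + 1))\<^sup>2 * cnt Y b + (cnt (Y - {m}) b)\<^sup>2 * cnt Y (b + 2))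
      \<le> real (2 * cnt (Y - {m}) b * cnt (Y - {m}) (b + 1) * cnt Y (b + 1))"
    using lim unfolding Y Q by simp
  then show ?thesis by (simp only: of_nat_le_iff)
qed

section \<open>Ratio bounds by moving one element of a linear extension\<close>

lemma move_right:
  assumes "A @ u # B @ p # C \<in> linexts Y" "\<And>y. y \<in> set B \<Longrightarrow> y \<sqsubset> p" "\<not> u \<sqsubset> p"
  shows "A @ B @ p # u # C \<in> linexts Y"
proof -
  have "\<not> u \<sqsubset> y" if "y \<in> set B" for y
    using assms(2)[OF that] assms(3) lt_trans by blast
  then show ?thesis using assms(1,3) unfolding linexts_def by (auto simp: sorted_wrt_append)
qed

lemma move_left:
  assumes "A @ p # B @ u # C \<in> linexts Y" "\<And>y. y \<in> set B \<Longrightarrow> p \<sqsubset> y" "\<not> p \<sqsubset> u"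
  shows "A @ u # p # B @ C \<in> linexts Y"
proof -
  have "\<not> y \<sqsubset> u" if "y \<in> set B" for y
    using assms(2)[OF that] assms(3) lt_trans by blast
  then show ?thesis using assms(1,3) unfolding linexts_def by (auto simp: sorted_wrt_append)
qed

text \<open>Some word has \<open>b\<close> letters after \<open>z\<close>, so at most
  \<open>b\<close> elements lie above \<open>z\<close>. Hence among \<open>b + 1\<close> letters
  after \<open>z\<close> one is not above it; the first such moves to just before \<open>z\<close>,
  and its old position has \<open>b + 1\<close> possibilities.\<close>

lemma cnt_shift_left:
  assumes fin: "finite Y" and pos: "cnt Y b > 0"
  shows "cnt Y (b + 1) \<le> (b + 1) * cnt Y b"
proof -
  \<comment> \<open>The inverse move: the last letter before \<open>z\<close> returns to index
    \<open>i\<close> of the part after \<open>z\<close>.\<close>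
  define g where "g i w = (let k = length w - b - 1; \<alpha> = take k w; \<beta> = drop (k + 1) w in
    butlast \<alpha> @ z # take i \<beta> @ last \<alpha> # drop i \<beta>)" for i and w :: "'a list"
  obtain w0 where w0: "w0 \<in> zlin Y b"
    using pos card_gt_0_iff[of "zlin Y b"] by (auto simp: cnt_def)
  then obtain \<alpha>0 \<beta>0 where ab0: "\<alpha>0 @ z # \<beta>0 \<in> linexts Y" "length \<beta>0 = b" by (auto simp: zlin_def)
  have "{y \<in> Y. z \<sqsubset> y} \<subseteq> set \<beta>0"
    using ab0 lt_irrefl by (auto simp: linexts_def sorted_wrt_append)
  then have above: "card {y \<in> Y. z \<sqsubset> y} \<le> b"
    using ab0(2) card_mono[of "set \<beta>0"] card_length[of \<beta>0] by (metis List.finite_set le_trans)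
  have "zlin Y (b + 1) \<subseteq> (\<lambda>(i, w). g i w) ` ({..b} \<times> zlin Y b)"
  proof
    fix w assume w: "w \<in> zlin Y (b + 1)"
    then obtain \<alpha> \<beta> where ab: "w = \<alpha> @ z # \<beta>" "length \<beta> = b + 1" "\<alpha> @ z # \<beta> \<in> linexts Y"
      by (auto simp: zlin_def)
    have "\<exists>u\<in>set \<beta>. \<not> z \<sqsubset> u"
    proof (rule ccontr)
      assume "\<not> (\<exists>u\<in>set \<beta>. \<not> z \<sqsubset> u)"
      then have "set \<beta> \<subseteq> {y \<in> Y. z \<sqsubset> y}" using ab by (auto simp: linexts_def)
      from card_mono[OF _ this] have "card (set \<beta>) \<le> b" using above fin by simp
      moreover have "card (set \<beta>) = b + 1" using ab by (auto simp: linexts_def distinct_card)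
      ultimately show False by simp
    qed
    then obtain \<beta>1 u \<beta>2 where u: "\<beta> = \<beta>1 @ u # \<beta>2" "\<not> z \<sqsubset> u" "\<forall>y\<in>set \<beta>1. z \<sqsubset> y"
      using split_list_first_prop[of \<beta> "\<lambda>u. \<not> z \<sqsubset> u"] by auto
    have "\<alpha> @ u # z # \<beta>1 @ \<beta>2 \<in> linexts Y"
      using ab u by (intro move_left) auto
    then have "(\<alpha> @ [u]) @ z # \<beta>1 @ \<beta>2 \<in> zlin Y b"
      using ab u by (intro zlinI) auto
    moreover have "w = g (length \<beta>1) ((\<alpha> @ [u]) @ z # \<beta>1 @ \<beta>2)"
      using ab u by (simp add: g_def Let_def)
    moreover have "length \<beta>1 \<in> {..b}" using ab u by simp
    ultimately show "w \<in> (\<lambda>(i, w). g i w) ` ({..b} \<times> zlin Y b)" by blast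
  qed
  then have "card (zlin Y (b + 1)) \<le> card ({..b} \<times> zlin Y b)"
    using fin by (intro surj_card_le) (auto simp: finite_zlin)
  then show ?thesis by (simp add: cnt_def card_cartesian_product)
qed

text \<open>Mirror image of \<open>cnt_shift_left\<close>; the number of old positions is bounded
  crudely by \<open>card Y\<close>.\<close>

lemma cnt_shift_right:
  assumes fin: "finite Y" and pos: "cnt Y (b + 1) > 0"
  shows "cnt Y b \<le> card Y * cnt Y (b + 1)"
proof -
  define g where "g i w = (let k = length w - b - 2; \<alpha> = take k w; \<beta> = drop (k + 1) w in
    take i \<alpha> @ hd \<beta> # drop i \<alpha> @ z # tl \<beta>)" for i and w :: "'a list"
  obtain w0 where w0: "w0 \<in> zlin Y (b + 1)"
    using pos card_gt_0_iff[of "zlin Y (b + 1)"] by (auto simp: cnt_def)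
  then obtain \<alpha>0 \<beta>0 where ab0: "\<alpha>0 @ z # \<beta>0 \<in> linexts Y" "length \<beta>0 = b + 1" by (auto simp: zlin_def)
  have "{y \<in> Y. y \<sqsubset> z} \<subseteq> set \<alpha>0"
    using ab0 lt_irrefl by (auto simp: linexts_def sorted_wrt_append)
  then have "card {y \<in> Y. y \<sqsubset> z} \<le> length \<alpha>0"
    using card_mono[of "set \<alpha>0"] card_length[of \<alpha>0] by (metis List.finite_set le_trans)
  then have below: "card {y \<in> Y. y \<sqsubset> z} + b + 2 \<le> card Y"
    using linexts_length[OF ab0(1)] ab0(2) by simp
  have "zlin Y b \<subseteq> (\<lambda>(i, w). g i w) ` ({..<card Y} \<times> zlin Y (b + 1))"
  proof
    fix w assume w: "w \<in> zlin Y b"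
    then obtain \<alpha> \<beta> where ab: "w = \<alpha> @ z # \<beta>" "length \<beta> = b" "\<alpha> @ z # \<beta> \<in> linexts Y"
      by (auto simp: zlin_def)
    have len: "length \<alpha> + b + 1 = card Y" using linexts_length[OF ab(3)] ab(2) by simp
    have "\<exists>u\<in>set \<alpha>. \<not> u \<sqsubset> z"
    proof (rule ccontr)
      assume "\<not> (\<exists>u\<in>set \<alpha>. \<not> u \<sqsubset> z)"
      then have "set \<alpha> \<subseteq> {y \<in> Y. y \<sqsubset> z}" using ab by (auto simp: linexts_def)
      from card_mono[OF _ this] have "card (set \<alpha>) + b + 2 \<le> card Y"
        using below fin by simp
      moreover have "card (set \<alpha>) = length \<alpha>" using ab by (auto simp: linexts_def distinct_card)
      ultimately show False using len by simp
    qed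
    then obtain \<alpha>1 u \<alpha>2 where u: "\<alpha> = \<alpha>1 @ u # \<alpha>2" "\<not> u \<sqsubset> z" "\<forall>y\<in>set \<alpha>2. y \<sqsubset> z"
      using split_list_last_prop[of \<alpha> "\<lambda>u. \<not> u \<sqsubset> z"] by auto
    have "\<alpha>1 @ \<alpha>2 @ z # u # \<beta> \<in> linexts Y"
      using ab u by (intro move_right) auto
    then have "(\<alpha>1 @ \<alpha>2) @ z # u # \<beta> \<in> zlin Y (b + 1)"
      using ab u by (intro zlinI) auto
    moreover have "w = g (length \<alpha>1) ((\<alpha>1 @ \<alpha>2) @ z # u # \<beta>)"
      using ab u by (simp add: g_def Let_def)
    moreover have "length \<alpha>1 \<in> {..<card Y}" using len u by simp
    ultimately show "w \<in> (\<lambda>(i, w). g i w) ` ({..<card Y} \<times> zlin Y (b + 1))" by blast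
  qed
  then have "card (zlin Y b) \<le> card ({..<card Y} \<times> zlin Y (b + 1))"
    using fin by (intro surj_card_le) (auto simp: finite_zlin)
  then show ?thesis by (simp add: cnt_def card_cartesian_product)
qed

lemma zlin_card: "w \<in> zlin Y b \<Longrightarrow> b + 1 \<le> card Y"
  by (auto simp: zlin_def dest: linexts_length)

text \<open>The cross inequality and the ratio bounds give
  \<open>q\<^sup>2 + p\<^sup>2 / r \<le> 2 * p * q\<close> for the products \<open>p\<close> and
  \<open>q\<close> to be compared. First this yields \<open>q / 2 \<le> p\<close>; inserting that
  into \<open>p\<^sup>2 / r\<close> gains the term \<open>1 / (8 * r)\<close>.\<close>

lemma cnt_ratio_inequality:
  assumes fin: "finite Y" and z: "z \<in> Y" and m: "(False, m) \<in> ends Y" and le: "card Y \<le> n"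
  shows "real (cnt Y b) * real (cnt (Y - {m}) (b + 1)) * (1 / 2 + 1 / (8 * real n * real (b + 1)))
    \<le> real (cnt Y (b + 1)) * real (cnt (Y - {m}) b)"
proof (cases "cnt Y b = 0 \<or> cnt (Y - {m}) (b + 1) = 0")
  case False
  have my: "m \<in> Y" using ends_mem[OF m] by simp
  obtain w where w: "w \<in> zlin (Y - {m}) (b + 1)"
    using False card_gt_0_iff[of "zlin (Y - {m}) (b + 1)"] by (auto simp: cnt_def)
  then have card: "b + 3 \<le> card Y" using zlin_card[OF w] my fin by simp
  \<comment> \<open>Appending \<open>m\<close> to a word of \<open>Y - {m}\<close> gives the
    positivity that \<open>cnt_shift_right\<close> requires.\<close>
  have "w @ [snd (False, m)] \<in> zlin Y (Suc (b + 1))"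
    unfolding zlin_upper using w m by auto
  then have AA: "cnt Y (b + 2) > 0"
    using fin by (auto simp: cnt_def card_gt_0_iff finite_zlin)
  have 1: "cnt Y (b + 1) \<le> (b + 1) * cnt Y b" using False by (intro cnt_shift_left fin) auto
  have 2: "cnt Y (b + 1) \<le> n * cnt Y (b + 2)"
    using cnt_shift_right[of Y "b + 1"] fin AA le
    by (metis (no_types, lifting) add.assoc le_trans mult_le_mono1 one_add_one)
  have 3: "(cnt (Y - {m}) (b + 1))\<^sup>2 * cnt Y b + (cnt (Y - {m}) b)\<^sup>2 * cnt Y (b + 2)
      \<le> 2 * cnt (Y - {m}) b * cnt (Y - {m}) (b + 1) * cnt Y (b + 1)"
    by (rule cnt_cross_inequality[OF fin z m card])
  define A C D E G where "A = real (cnt Y (b + 2))" and "C = real (cnt Y (b + 1))" and "D = real (cnt Y b)"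
    and "E = real (cnt (Y - {m}) (b + 1))" and "G = real (cnt (Y - {m}) b)"
  define r where "r = real n * real (b + 1)"
  have rpos: "r > 0" using card le by (simp add: r_def)
  have pos: "D > 0" "E > 0" "A \<ge> 0" "C \<ge> 0" "G \<ge> 0" using False by (simp_all add: A_def C_def D_def E_def G_def)
  have "C \<le> real (b + 1) * D" "C \<le> real n * A"
    using 1 2 unfolding A_def C_def D_def by (metis of_nat_le_iff of_nat_mult)+
  then have "C * C \<le> (real (b + 1) * D) * (real n * A)"
    using pos by (intro mult_mono) auto
  then have CC: "C\<^sup>2 \<le> r * (A * D)" by (simp add: r_def power2_eq_square algebra_simps)
  have "real ((cnt (Y - {m}) (b + 1))\<^sup>2 * cnt Y b + (cnt (Y - {m}) b)\<^sup>2 * cnt Y (b + 2))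
      \<le> real (2 * cnt (Y - {m}) b * cnt (Y - {m}) (b + 1) * cnt Y (b + 1))"
    using 3 of_nat_le_iff by blast
  then have cross: "E\<^sup>2 * D + G\<^sup>2 * A \<le> 2 * G * E * C"
    by (simp add: A_def C_def D_def E_def G_def)
  define p q where "p = C * G" and "q = D * E"
  have q: "q > 0" using pos by (simp add: q_def)
  have "(E\<^sup>2 * D + G\<^sup>2 * A) * D \<le> 2 * G * E * C * D"
    using cross pos by (intro mult_right_mono) auto
  then have "q\<^sup>2 + G\<^sup>2 * (A * D) \<le> 2 * p * q"
    by (simp add: p_def q_def power2_eq_square algebra_simps)
  moreover have "G\<^sup>2 * (C\<^sup>2 / r) \<le> G\<^sup>2 * (A * D)"
    using CC rpos by (intro mult_left_mono) (simp_all add: pos_divide_le_eq mult.commute)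
  moreover have "G\<^sup>2 * (C\<^sup>2 / r) = p\<^sup>2 / r" by (simp add: p_def power_mult_distrib)
  ultimately have pq: "q\<^sup>2 + p\<^sup>2 / r \<le> 2 * p * q" by linarith
  have "q * q \<le> (2 * p) * q"
  proof -
    have "p\<^sup>2 / r \<ge> 0" using rpos by simp
    with pq have "q\<^sup>2 \<le> 2 * p * q" by linarith
    then show ?thesis by (simp add: power2_eq_square)
  qed
  then have half: "q / 2 \<le> p" using q by simp
  then have "(q / 2)\<^sup>2 \<le> p\<^sup>2" using q by (intro power_mono) auto
  then have "(q / 2)\<^sup>2 / r \<le> p\<^sup>2 / r" using rpos by (simp add: divide_right_mono)
  with pq have "q * (q * (1 / 2 + 1 / (8 * r))) \<le> q * p"
    using rpos by (simp add: power2_eq_square field_simps)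
  then have "q * (1 / 2 + 1 / (8 * r)) \<le> p" using q by simp
  then show ?thesis by (simp add: p_def q_def r_def C_def D_def E_def G_def mult.assoc)
qed auto

end

section \<open>Three elements in a chain\<close>

definition list_index :: "'a list \<Rightarrow> 'a \<Rightarrow> nat" where
  "list_index w x = length (takeWhile (\<lambda>y. y \<noteq> x) w)"

lemma list_index_less: "x \<in> set w \<Longrightarrow> list_index w x < length w"
  unfolding list_index_def by (induction w) auto

lemma nth_list_index: "x \<in> set w \<Longrightarrow> w ! list_index w x = x"
  unfolding list_index_def by (induction w) auto

lemma list_index_nth: "distinct w \<Longrightarrow> i < length w \<Longrightarrow> list_index w (w ! i) = i"
  using list_index_less[of "w ! i" w] nth_list_index[of "w ! i" w] nth_eq_iff_index_eq by fastforce

lemma split_at_three_positions: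
  assumes "p + Suc a + Suc b < length w"
  shows "\<exists>\<alpha> \<beta> \<gamma> \<delta>. w = \<alpha> @ w ! p # \<beta> @ w ! (p + Suc a) # \<gamma> @ w ! (p + Suc a + Suc b) # \<delta>
    \<and> length \<beta> = a \<and> length \<gamma> = b"
proof -
  define v where "v = drop (Suc p) w"
  define u where "u = drop (Suc a) v"
  have "w = take p w @ w ! p # v" using assms unfolding v_def by (intro id_take_nth_drop) auto
  moreover have "v = take a v @ v ! a # u" using assms unfolding u_def v_def by (intro id_take_nth_drop) auto
  moreover have "u = take b u @ u ! b # drop (Suc b) u" using assms unfolding u_def v_def by (intro id_take_nth_drop) auto
  moreover have "v ! a = w ! (p + Suc a)" "u ! b = w ! (p + Suc a + Suc b)"
    using assms unfolding u_def v_def by (simp_all add: algebra_simps)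
  moreover have "length (take a v) = a" "length (take b u) = b"
    using assms by (simp_all add: u_def v_def)
  ultimately show ?thesis by metis
qed

text \<open>The distinguished point is \<open>z1\<close>: after a cut in front of \<open>z2\<close>,
  the first gap is the number of letters behind \<open>z1\<close>.\<close>

locale three_chain = pointed_order lt z1
  for lt :: "'a \<Rightarrow> 'a \<Rightarrow> bool" (infix "\<sqsubset>" 50) and z1 +
  fixes X :: "'a set" and z2 z3 :: 'a
  assumes finite_X: "finite X" and z_in: "z1 \<in> X" "z2 \<in> X" "z3 \<in> X"
    and z12: "z1 \<sqsubset> z2" and z23: "z2 \<sqsubset> z3"
begin

text \<open>The arguments count elements strictly between, hence are one less than the differences
  of positions.\<close>

definition gaplists :: "nat \<Rightarrow> nat \<Rightarrow> 'a list set" where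
  "gaplists a b = {w \<in> linexts X. \<exists>\<alpha> \<beta> \<gamma> \<delta>. w = \<alpha> @ z1 # \<beta> @ z2 # \<gamma> @ z3 # \<delta>
     \<and> length \<beta> = a \<and> length \<gamma> = b}"

lemma gaplistsI:
  "\<alpha> @ z1 # \<beta> @ z2 # \<gamma> @ z3 # \<delta> \<in> linexts X \<Longrightarrow> length \<beta> = a \<Longrightarrow> length \<gamma> = b \<Longrightarrow>
   \<alpha> @ z1 # \<beta> @ z2 # \<gamma> @ z3 # \<delta> \<in> gaplists a b"
  unfolding gaplists_def by blast

lemma gaplistsE:
  assumes "gaplists a b \<noteq> {}"
  obtains \<alpha> \<beta> \<gamma> \<delta> where "\<alpha> @ z1 # \<beta> @ z2 # \<gamma> @ z3 # \<delta> \<in> linexts X" "length \<beta> = a" "length \<gamma> = b"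
  using assms unfolding gaplists_def by blast

lemma gap_count_eq_card_gaplists:
  "lin_ext_gap_count X lt z1 z2 z3 (Suc a) (Suc b) = card (gaplists a b)"
proof -
  \<comment> \<open>Linear extensions take values from 1, list indices start at 0, hence
    \<open>Suc\<close>; the restriction to \<open>X\<close> makes \<open>T w\<close>
    extensional.\<close>
  define T where "T w = (\<lambda>x\<in>X. Suc (list_index w x))" for w
  let ?L = "{L \<in> linear_extensions X lt.
    int (L z2) - int (L z1) = int (Suc a) \<and> int (L z3) - int (L z2) = int (Suc b)}"
  have lin: "distinct w" "set w = X" "length w = card X" if "w \<in> gaplists a b" for w
    using that linexts_length[of w X] by (auto simp: gaplists_def linexts_def)
  have inj: "inj_on T (gaplists a b)"
  proof (rule inj_onI)
    fix w v assume w: "w \<in> gaplists a b" and v: "v \<in> gaplists a b" and eq: "T w = T v"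
    show "w = v"
    proof (rule nth_equalityI)
      show "length w = length v" using lin[OF w] lin[OF v] by simp
      fix i assume i: "i < length w"
      have x: "w ! i \<in> X" using i lin[OF w] nth_mem by blast
      have "list_index v (w ! i) = i"
        using fun_cong[OF eq, of "w ! i"] x list_index_nth[OF lin(1)[OF w] i] by (simp add: T_def)
      then show "w ! i = v ! i" using nth_list_index[of "w ! i" v] x lin[OF v] by simp
    qed
  qed
  have "T ` gaplists a b = ?L"
  proof (intro subset_antisym subsetI)
    fix L assume "L \<in> T ` gaplists a b"
    then obtain w where w: "w \<in> gaplists a b" and L: "L = T w" by blast
    note wl = lin[OF w]
    have idx: "list_index w x < card X" "w ! list_index w x = x" if "x \<in> X" for x
      using list_index_less[of x w] nth_list_index[of x w] that wl by auto
    have injL: "inj_on L X"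
    proof (rule inj_onI)
      fix x y assume "x \<in> X" "y \<in> X" "L x = L y"
      then have "list_index w x = list_index w y" by (simp add: L T_def)
      then show "x = y" using idx(2)[OF \<open>x \<in> X\<close>] idx(2)[OF \<open>y \<in> X\<close>] by metis
    qed
    have "L ` X \<subseteq> {1..card X}" using idx by (auto simp: L T_def Suc_le_eq)
    then have "L ` X = {1..card X}"
      using card_image[OF injL] by (intro card_subset_eq) auto
    then have bij: "bij_betw L X {1..card X}" using injL by (simp add: bij_betw_def)
    have mono: "L u < L v" if uv: "u \<in> X" "v \<in> X" "u \<sqsubset> v" for u v
    proof (rule ccontr)
      assume "\<not> L u < L v"
      then have "list_index w v \<le> list_index w u" using uv by (simp add: L T_def)
      moreover have "list_index w v \<noteq> list_index w u"
        using idx(2)[OF uv(1)] idx(2)[OF uv(2)] uv(3) lt_irrefl by metis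
      ultimately have "list_index w v < list_index w u" by simp
      moreover have "sorted_wrt (\<lambda>x y. \<not> y \<sqsubset> x) w" using w by (auto simp: gaplists_def linexts_def)
      ultimately show False
        using sorted_wrt_nth_less[of _ w "list_index w v" "list_index w u"] idx uv wl by metis
    qed
    obtain \<alpha> \<beta> \<gamma> \<delta> where d: "w = \<alpha> @ z1 # \<beta> @ z2 # \<gamma> @ z3 # \<delta>" "length \<beta> = a" "length \<gamma> = b"
      using w by (auto simp: gaplists_def)
    have "L z1 = Suc (length \<alpha>)" "L z2 = Suc (length \<alpha> + Suc a)" "L z3 = Suc (length \<alpha> + Suc a + Suc b)"
      using wl(1) d z_in by (auto simp: L T_def list_index_def takeWhile_append)
    then show "L \<in> ?L"
      using bij mono by (auto simp: linear_extensions_def L T_def)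
  next
    fix L assume L: "L \<in> ?L"
    then have ext: "L \<in> extensional X" and bij: "bij_betw L X {1..card X}"
      and mono: "\<And>u v. u \<in> X \<Longrightarrow> v \<in> X \<Longrightarrow> u \<sqsubset> v \<Longrightarrow> L u < L v"
      and g1: "int (L z2) - int (L z1) = int (Suc a)" and g2: "int (L z3) - int (L z2) = int (Suc b)"
      by (auto simp: linear_extensions_def)
    define w where "w = map (inv_into X L) [1..<Suc (card X)]"
    have len: "length w = card X" by (simp add: w_def)
    have ibij: "bij_betw (inv_into X L) {1..card X} X" using bij by (rule bij_betw_inv_into)
    have "set w = inv_into X L ` {1..card X}" by (simp add: w_def atLeastLessThanSuc_atLeastAtMost del: upt_Suc)
    then have set: "set w = X" using bij_betw_imp_surj_on[OF ibij] by simp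
    have dist: "distinct w" using set len by (intro card_distinct) simp
    have nth: "w ! i \<in> X" "L (w ! i) = Suc i" if "i < card X" for i
    proof -
      have wi: "w ! i = inv_into X L (Suc i)" using that by (simp add: w_def del: upt_Suc)
      have "Suc i \<in> L ` X" using bij that by (auto simp: bij_betw_def)
      then show "w ! i \<in> X" "L (w ! i) = Suc i" unfolding wi by (auto intro: inv_into_into f_inv_into_f)
    qed
    have TL: "T w = L"
    proof
      fix x show "T w x = L x"
      proof (cases "x \<in> X")
        case True
        then show ?thesis
          using nth(2)[of "list_index w x"] nth_list_index[of x w] list_index_less[of x w] set len
          by (simp add: T_def)
      next
        case False then show ?thesis using ext by (simp add: T_def extensional_def)
      qed
    qed
    have "sorted_wrt (\<lambda>x y. \<not> y \<sqsubset> x) w"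
      unfolding sorted_wrt_iff_nth_less
    proof (intro allI impI notI)
      fix i j assume "i < j" "j < length w" "w ! j \<sqsubset> w ! i"
      then show False using mono[of "w ! j" "w ! i"] nth[of i] nth[of j] len by simp
    qed
    then have lin: "w \<in> linexts X" using dist set by (simp add: linexts_def)
    define p where "p = list_index w z1"
    have Lz: "L z = Suc (list_index w z)" if "z \<in> X" for z
      using that TL by (auto simp: T_def)
    have p2: "list_index w z2 = p + Suc a" and p3: "list_index w z3 = p + Suc a + Suc b"
      using g1 g2 Lz z_in by (auto simp: p_def)
    have "p + Suc a + Suc b < length w" using list_index_less[of z3 w] set z_in p3 by simp
    from split_at_three_positions[OF this] have "w \<in> gaplists a b"
      using lin nth_list_index[of z1 w] nth_list_index[of z2 w] nth_list_index[of z3 w] p2 p3 set z_in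
      by (simp add: gaplists_def p_def)
    then show "L \<in> T ` gaplists a b" using TL by blast
  qed
  then have "card ?L = card (gaplists a b)" using card_image[OF inj] by simp
  then show ?thesis by (simp only: lin_ext_gap_count_def)
qed

text \<open>The possible parts of a linear extension from \<open>z2\<close> on; being up-closed,
  they admit any linear extension of the complement in front.\<close>

definition suffixes :: "nat \<Rightarrow> 'a list set" where
  "suffixes b = {\<sigma>. distinct \<sigma> \<and> set \<sigma> \<subseteq> X \<and> sorted_wrt (\<lambda>x y. \<not> y \<sqsubset> x) \<sigma> \<and>
     (\<forall>s\<in>set \<sigma>. \<forall>y\<in>X - set \<sigma>. \<not> s \<sqsubset> y) \<and> (\<exists>\<gamma> \<delta>. \<sigma> = z2 # \<gamma> @ z3 # \<delta> \<and> length \<gamma> = b)}"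

lemma append_linexts:
  "\<pi> @ \<sigma> \<in> linexts X \<longleftrightarrow> distinct \<sigma> \<and> set \<sigma> \<subseteq> X \<and> sorted_wrt (\<lambda>x y. \<not> y \<sqsubset> x) \<sigma> \<and>
     (\<forall>s\<in>set \<sigma>. \<forall>y\<in>X - set \<sigma>. \<not> s \<sqsubset> y) \<and> \<pi> \<in> linexts (X - set \<sigma>)"
  by (auto simp: linexts_def sorted_wrt_append)

lemma finite_suffixes: "finite (suffixes b)"
  by (rule finite_subset[OF _ finite_subset_distinct[OF finite_X]]) (auto simp: suffixes_def)

text \<open>Each word is cut in front of \<open>z2\<close>; as \<open>z2\<close> occurs only once,
  the cut is unique.\<close>

lemma card_gaplists: "card (gaplists a b) = (\<Sum>\<sigma>\<in>suffixes b. cnt (X - set \<sigma>) a)"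
proof -
  have "gaplists a b = (\<Union>\<sigma>\<in>suffixes b. (\<lambda>\<pi>. \<pi> @ \<sigma>) ` zlin (X - set \<sigma>) a)"
  proof (intro subset_antisym subsetI)
    fix w assume "w \<in> gaplists a b"
    then obtain \<alpha> \<beta> \<gamma> \<delta> where d: "w = (\<alpha> @ z1 # \<beta>) @ (z2 # \<gamma> @ z3 # \<delta>)" "length \<beta> = a" "length \<gamma> = b"
      and lin: "(\<alpha> @ z1 # \<beta>) @ (z2 # \<gamma> @ z3 # \<delta>) \<in> linexts X"
      by (auto simp: gaplists_def)
    have "z2 # \<gamma> @ z3 # \<delta> \<in> suffixes b"
      using lin d(3) unfolding append_linexts suffixes_def by blast
    moreover have "\<alpha> @ z1 # \<beta> \<in> zlin (X - set (z2 # \<gamma> @ z3 # \<delta>)) a"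
      using lin d(2) unfolding append_linexts by (intro zlinI) blast+
    ultimately show "w \<in> (\<Union>\<sigma>\<in>suffixes b. (\<lambda>\<pi>. \<pi> @ \<sigma>) ` zlin (X - set \<sigma>) a)"
      unfolding d(1) by blast
  next
    fix w assume "w \<in> (\<Union>\<sigma>\<in>suffixes b. (\<lambda>\<pi>. \<pi> @ \<sigma>) ` zlin (X - set \<sigma>) a)"
    then obtain \<pi> \<sigma> where s: "\<sigma> \<in> suffixes b" and p: "\<pi> \<in> zlin (X - set \<sigma>) a" and w: "w = \<pi> @ \<sigma>"
      by blast
    then have "w \<in> linexts X" unfolding w append_linexts by (auto simp: suffixes_def zlin_def)
    moreover obtain \<gamma> \<delta> where "\<sigma> = z2 # \<gamma> @ z3 # \<delta>" "length \<gamma> = b" using s by (auto simp: suffixes_def)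
    moreover obtain \<alpha> \<beta> where "\<pi> = \<alpha> @ z1 # \<beta>" "length \<beta> = a" using p by (auto simp: zlin_def)
    ultimately show "w \<in> gaplists a b" using gaplistsI[of \<alpha> \<beta> \<gamma> \<delta> a b] w by simp
  qed
  moreover have "card (\<Union>\<sigma>\<in>suffixes b. (\<lambda>\<pi>. \<pi> @ \<sigma>) ` zlin (X - set \<sigma>) a)
      = (\<Sum>\<sigma>\<in>suffixes b. card (zlin (X - set \<sigma>) a))"
  proof (rule card_disjoint_images)
    fix \<sigma> \<sigma>' \<pi> \<pi>'
    assume s: "\<sigma> \<in> suffixes b" "\<sigma>' \<in> suffixes b" "\<pi> \<in> zlin (X - set \<sigma>) a" "\<pi>' \<in> zlin (X - set \<sigma>') a"
      and eq: "\<pi> @ \<sigma> = \<pi>' @ \<sigma>'"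
    obtain \<tau> \<tau>' where t: "\<sigma> = z2 # \<tau>" "\<sigma>' = z2 # \<tau>'" using s by (auto simp: suffixes_def)
    have "z2 \<notin> set \<pi>" "z2 \<notin> set \<tau>" using s t by (auto simp: zlin_def linexts_def suffixes_def)
    moreover have "z2 \<notin> set \<pi>'" using s t by (auto simp: zlin_def linexts_def)
    ultimately show "\<sigma> = \<sigma>'" using eq unfolding t by (simp add: append_Cons_eq_iff)
  qed (auto simp: finite_suffixes finite_zlin finite_X inj_on_def)
  ultimately show ?thesis by (simp add: cnt_def)
qed

definition below where "below = {x \<in> X. x \<sqsubset> z2}"

definition middle where
  "middle = {x \<in> X. x \<noteq> z2 \<and> \<not> x \<sqsubset> z2 \<and> x \<noteq> z3 \<and> \<not> z3 \<sqsubset> x}"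

lemma gap_subset_middle:
  assumes "sorted_wrt (\<lambda>x y. \<not> y \<sqsubset> x) (\<alpha> @ z2 # \<gamma> @ z3 # \<delta>)" "distinct (\<alpha> @ z2 # \<gamma> @ z3 # \<delta>)"
    "set \<gamma> \<subseteq> X"
  shows "set \<gamma> \<subseteq> middle"
  using assms by (auto simp: middle_def sorted_wrt_append)

text \<open>Otherwise a word with gaps \<open>Suc k\<close> and \<open>l\<close> could be rearranged
  into one with gaps \<open>k\<close> and \<open>Suc l\<close>: one element leaves the first gap
  across \<open>z1\<close>, and a further element not forced outside the second gap enters
  it.\<close>

lemma card_middle_le:
  assumes k: "gaplists k b' \<noteq> {}" and kl: "gaplists (Suc k) l \<noteq> {}" and zero: "gaplists k (Suc l) = {}"
  shows "card middle \<le> l"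
proof (rule ccontr)
  assume "\<not> card middle \<le> l"
  then have big: "card middle > l" by simp
  obtain \<alpha> \<beta> \<gamma> \<delta> where w: "\<alpha> @ z1 # \<beta> @ z2 # \<gamma> @ z3 # \<delta> \<in> linexts X" "length \<beta> = Suc k" "length \<gamma> = l"
    using kl by (rule gaplistsE)
  obtain \<alpha>0 \<beta>0 \<gamma>0 \<delta>0 where w0: "\<alpha>0 @ z1 # \<beta>0 @ z2 # \<gamma>0 @ z3 # \<delta>0 \<in> linexts X" "length \<beta>0 = k"
    using k by (rule gaplistsE)
  \<comment> \<open>A word with first gap \<open>k\<close> exists, so the order forces at most
    \<open>k\<close> elements between \<open>z1\<close> and \<open>z2\<close>.\<close>
  have "{x \<in> X. z1 \<sqsubset> x \<and> x \<sqsubset> z2} \<subseteq> set \<beta>0"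
    using w0(1) lt_irrefl by (auto simp: linexts_def sorted_wrt_append)
  from card_mono[OF _ this] have inner: "card {x \<in> X. z1 \<sqsubset> x \<and> x \<sqsubset> z2} \<le> k"
    using card_length[of \<beta>0] w0(2) by simp
  \<comment> \<open>Otherwise an element could pass from the first gap directly across
    \<open>z2\<close> into the second.\<close>
  have below\<beta>: "u \<sqsubset> z2" if u: "u \<in> set \<beta>" for u
  proof (rule ccontr)
    assume "\<not> u \<sqsubset> z2"
    then obtain \<beta>1 v \<beta>2 where b: "\<beta> = \<beta>1 @ v # \<beta>2" "\<not> v \<sqsubset> z2" "\<forall>y\<in>set \<beta>2. y \<sqsubset> z2"
      using split_list_last_prop[of \<beta> "\<lambda>u. \<not> u \<sqsubset> z2"] u by auto
    have "(\<alpha> @ z1 # \<beta>1) @ v # \<beta>2 @ z2 # (\<gamma> @ z3 # \<delta>) \<in> linexts X" using w b by simp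
    from move_right[OF this] b have "\<alpha> @ z1 # (\<beta>1 @ \<beta>2) @ z2 # (v # \<gamma>) @ z3 # \<delta> \<in> linexts X" by simp
    then have "gaplists k (Suc l) \<noteq> {}" using w b gaplistsI[of \<alpha> "\<beta>1 @ \<beta>2" "v # \<gamma>" \<delta> k "Suc l"] by auto
    then show False using zero by simp
  qed
  \<comment> \<open>By counting, some element of the first gap is not above \<open>z1\<close>;
    moving it in front of \<open>z1\<close> shortens this gap to \<open>k\<close>.\<close>
  have "\<exists>u\<in>set \<beta>. \<not> z1 \<sqsubset> u"
  proof (rule ccontr)
    assume "\<not> (\<exists>u\<in>set \<beta>. \<not> z1 \<sqsubset> u)"
    then have "set \<beta> \<subseteq> {x \<in> X. z1 \<sqsubset> x \<and> x \<sqsubset> z2}" using w(1) below\<beta> by (auto simp: linexts_def)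
    from card_mono[OF _ this] have "card (set \<beta>) \<le> k" using inner finite_X by simp
    moreover have "card (set \<beta>) = Suc k" using w by (auto simp: linexts_def distinct_card)
    ultimately show False by simp
  qed
  then obtain \<beta>1 u \<beta>2 where b: "\<beta> = \<beta>1 @ u # \<beta>2" "\<not> z1 \<sqsubset> u" "\<forall>y\<in>set \<beta>1. z1 \<sqsubset> y"
    using split_list_first_prop[of \<beta> "\<lambda>u. \<not> z1 \<sqsubset> u"] by auto
  have "\<alpha> @ z1 # \<beta>1 @ u # (\<beta>2 @ z2 # \<gamma> @ z3 # \<delta>) \<in> linexts X" using w b by simp
  from move_left[OF this] b
  have w': "(\<alpha> @ [u]) @ z1 # (\<beta>1 @ \<beta>2) @ z2 # \<gamma> @ z3 # \<delta> \<in> linexts X" by simp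
  have "\<not> middle \<subseteq> set \<gamma>"
  proof
    assume "middle \<subseteq> set \<gamma>"
    from card_mono[OF _ this] have "card middle \<le> l" using card_length[of \<gamma>] w(3) by simp
    then show False using big by simp
  qed
  then obtain m where m: "m \<in> middle" "m \<notin> set \<gamma>" by blast
  have "m \<in> set ((\<alpha> @ [u]) @ z1 # (\<beta>1 @ \<beta>2) @ z2 # \<gamma> @ z3 # \<delta>)"
    using m w' by (auto simp: linexts_def middle_def)
  moreover have "m \<notin> set \<beta>" "m \<noteq> z1" using m below\<beta> z12 by (auto simp: middle_def)
  ultimately consider "m \<in> set \<alpha>" | "m \<in> set \<delta>" using m b by (auto simp: middle_def)
  then have "gaplists k (Suc l) \<noteq> {}"
  proof cases
    case 1
    have "\<not> m \<sqsubset> z2" using m by (simp add: middle_def)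
    \<comment> \<open>The last letter of \<open>\<alpha>\<close> not below \<open>z2\<close> can
      pass \<open>z2\<close>, since all letters in between are below \<open>z2\<close>.\<close>
    then obtain \<alpha>1 v \<alpha>2 where a: "\<alpha> = \<alpha>1 @ v # \<alpha>2" "\<not> v \<sqsubset> z2" "\<forall>y\<in>set \<alpha>2. y \<sqsubset> z2"
      using split_list_last_prop[of \<alpha> "\<lambda>u. \<not> u \<sqsubset> z2"] 1 by auto
    have "\<alpha>1 @ v # (\<alpha>2 @ u # z1 # \<beta>1 @ \<beta>2) @ z2 # (\<gamma> @ z3 # \<delta>) \<in> linexts X" using w' a by simp
    from move_right[OF this] a b below\<beta> z12
    have "(\<alpha>1 @ \<alpha>2 @ [u]) @ z1 # (\<beta>1 @ \<beta>2) @ z2 # (v # \<gamma>) @ z3 # \<delta> \<in> linexts X" by auto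
    then show ?thesis
      using w b gaplistsI[of "\<alpha>1 @ \<alpha>2 @ [u]" "\<beta>1 @ \<beta>2" "v # \<gamma>" \<delta> k "Suc l"] by auto
  next
    case 2
    have "\<not> z3 \<sqsubset> m" using m by (simp add: middle_def)
    \<comment> \<open>Dually, the first letter after \<open>z3\<close> not above it moves to just
      before \<open>z3\<close>.\<close>
    then obtain \<delta>1 v \<delta>2 where d: "\<delta> = \<delta>1 @ v # \<delta>2" "\<not> z3 \<sqsubset> v" "\<forall>y\<in>set \<delta>1. z3 \<sqsubset> y"
      using split_list_first_prop[of \<delta> "\<lambda>u. \<not> z3 \<sqsubset> u"] 2 by auto
    have "(\<alpha> @ u # z1 # \<beta>1 @ \<beta>2 @ z2 # \<gamma>) @ z3 # \<delta>1 @ v # \<delta>2 \<in> linexts X" using w' d by simp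
    from move_left[OF this] d
    have "(\<alpha> @ [u]) @ z1 # (\<beta>1 @ \<beta>2) @ z2 # (\<gamma> @ [v]) @ z3 # (\<delta>1 @ \<delta>2) \<in> linexts X" by simp
    then show ?thesis
      using w b gaplistsI[of "\<alpha> @ [u]" "\<beta>1 @ \<beta>2" "\<gamma> @ [v]" "\<delta>1 @ \<delta>2" k "Suc l"] by auto
  qed
  then show False using zero by simp
qed

text \<open>Up-closedness keeps everything above \<open>z3\<close> inside \<open>\<sigma>\<close>,
  and the gap uses up \<open>b\<close> elements of \<open>middle\<close>.\<close>

lemma suffix_complement:
  assumes "\<sigma> \<in> suffixes b"
  shows "below \<subseteq> X - set \<sigma>" and "X - set \<sigma> \<subseteq> below \<union> middle"
    and "card ((X - set \<sigma>) \<inter> middle) + b \<le> card middle"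
proof -
  obtain \<gamma> \<delta> where s: "\<sigma> = z2 # \<gamma> @ z3 # \<delta>" "length \<gamma> = b" and dist: "distinct \<sigma>" and sub: "set \<sigma> \<subseteq> X"
    and sorted: "sorted_wrt (\<lambda>x y. \<not> y \<sqsubset> x) \<sigma>" and up: "\<forall>s\<in>set \<sigma>. \<forall>y\<in>X - set \<sigma>. \<not> s \<sqsubset> y"
    using assms by (auto simp: suffixes_def)
  show "below \<subseteq> X - set \<sigma>"
    using sorted lt_irrefl z23 unfolding s by (auto simp: below_def)
  show "X - set \<sigma> \<subseteq> below \<union> middle"
    using up unfolding s by (auto simp: below_def middle_def)
  have "set \<gamma> \<subseteq> middle"
    using gap_subset_middle[of "[]" \<gamma> \<delta>] sorted dist sub unfolding s by auto
  moreover have "finite middle" using finite_X by (simp add: middle_def)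
  moreover have "card (set \<gamma>) = b" using dist s by (simp add: distinct_card)
  moreover have "((X - set \<sigma>) \<inter> middle) \<inter> set \<gamma> = {}" unfolding s by auto
  ultimately show "card ((X - set \<sigma>) \<inter> middle) + b \<le> card middle"
    using card_Un_disjoint[of "(X - set \<sigma>) \<inter> middle" "set \<gamma>"] finite_X
      card_mono[of middle "((X - set \<sigma>) \<inter> middle) \<union> set \<gamma>"] by auto
qed

text \<open>As \<open>middle\<close> has at most \<open>l + 1\<close> elements, a suffix with gap
  \<open>l + 1\<close> leaves exactly \<open>below\<close>, and one with gap \<open>l\<close> leaves
  \<open>below\<close> plus at most one maximal element. So the counts with second gap
  \<open>l + 1\<close> are multiples of those for \<open>below\<close>, and the rest is compared
  suffix by suffix.\<close>

lemma gaplists_inequality: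
  assumes n: "card X = n" and zero: "gaplists k (l + 2) = {}"
  shows "real (card (gaplists k l)) * real (card (gaplists (k + 1) (l + 1))) *
      (1 / 2 + 1 / (8 * real n * real (k + 1)))
    \<le> real (card (gaplists (k + 1) l)) * real (card (gaplists k (l + 1)))"
proof (cases "gaplists k l = {} \<or> gaplists (k + 1) (l + 1) = {}")
  case True
  then show ?thesis by auto
next
  case False
  have M: "card middle \<le> l + 1"
    using card_middle_le[of k l "l + 1"] False zero by simp
  have finM: "finite middle" using finite_X by (simp add: middle_def)
  have disj: "below \<inter> middle = {}" by (auto simp: below_def middle_def)
  have z1: "z1 \<in> below" using z12 z_in by (simp add: below_def)
  have long: "X - set \<sigma> = below" if s: "\<sigma> \<in> suffixes (l + 1)" for \<sigma>
  proof -
    have "card ((X - set \<sigma>) \<inter> middle) = 0" using suffix_complement(3)[OF s] M by simp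
    then have "(X - set \<sigma>) \<inter> middle = {}" using finM by simp
    then show ?thesis using suffix_complement(1,2)[OF s] by blast
  qed
  have top: "card (gaplists a (l + 1)) = card (suffixes (l + 1)) * cnt below a" for a
    unfolding card_gaplists by (simp add: long)
  define c where "c = (1 / 2 + 1 / (8 * real n * real (k + 1)))"
  have fib: "real (cnt (X - set \<sigma>) k) * real (cnt below (k + 1)) * c
      \<le> real (cnt (X - set \<sigma>) (k + 1)) * real (cnt below k)" if s: "\<sigma> \<in> suffixes l" for \<sigma>
  proof (cases "(X - set \<sigma>) \<inter> middle = {}")
    case True
    \<comment> \<open>Both sides now contain the same counts, so \<open>c \<le> 1\<close>
      suffices.\<close>
    then have Y: "X - set \<sigma> = below" using suffix_complement(1,2)[OF s] by blast
    have "n \<ge> 1" using n finite_X z_in by (metis One_nat_def Suc_leI card_gt_0_iff empty_iff)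
    then have "1 * 1 \<le> real n * real (k + 1)" by (intro mult_mono) auto
    then have "1 / (8 * (real n * real (k + 1))) \<le> 1 / 8"
      by (intro divide_left_mono) auto
    then have "c \<le> 1" unfolding c_def mult.assoc by linarith
    from mult_left_mono[OF this, of "real (cnt below k) * real (cnt below (k + 1))"]
    show ?thesis unfolding Y by (simp add: mult.commute)
  next
    case False
    then have "card ((X - set \<sigma>) \<inter> middle) \<noteq> 0" using finM by simp
    then have "card ((X - set \<sigma>) \<inter> middle) = 1" using suffix_complement(3)[OF s] M by simp
    then obtain m where m: "(X - set \<sigma>) \<inter> middle = {m}" by (auto simp: card_1_singleton_iff)
    have Y: "X - set \<sigma> = insert m below" "m \<notin> below" "m \<in> middle"
      using m suffix_complement(1,2)[OF s] disj by blast+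
    \<comment> \<open>If \<open>m\<close> lay below an element of \<open>below\<close>, it would lie
      below \<open>z2\<close>, contrary to its membership in \<open>middle\<close>.\<close>
    have "\<not> m \<sqsubset> y" if "y \<in> insert m below" for y
      using that Y(3) lt_irrefl lt_trans unfolding below_def middle_def by blast
    then have me: "(False, m) \<in> ends (X - set \<sigma>)" unfolding Y(1)
      using Y(2) z1 by (auto simp: ends_def)
    have "X - set \<sigma> - {m} = below" using Y by auto
    moreover have "card (X - set \<sigma>) \<le> n" using n finite_X by (auto intro: card_mono)
    moreover have "z1 \<in> X - set \<sigma>" using z1 Y by simp
    ultimately show ?thesis
      using cnt_ratio_inequality[of "X - set \<sigma>" m n k] me finite_X by (simp add: c_def)
  qed
  have "real (card (gaplists k l)) * real (cnt below (k + 1)) * c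
      = (\<Sum>\<sigma>\<in>suffixes l. real (cnt (X - set \<sigma>) k) * real (cnt below (k + 1)) * c)"
    unfolding card_gaplists by (simp add: sum_distrib_right)
  also have "\<dots> \<le> (\<Sum>\<sigma>\<in>suffixes l. real (cnt (X - set \<sigma>) (k + 1)) * real (cnt below k))"
    by (intro sum_mono fib)
  also have "\<dots> = real (card (gaplists (k + 1) l)) * real (cnt below k)"
    unfolding card_gaplists by (simp add: sum_distrib_right)
  finally have "real (card (suffixes (l + 1))) * (real (card (gaplists k l)) * real (cnt below (k + 1)) * c)
      \<le> real (card (suffixes (l + 1))) * (real (card (gaplists (k + 1) l)) * real (cnt below k))"
    by (intro mult_left_mono) auto
  then show ?thesis unfolding top c_def[symmetric] by (simp add: mult_ac)
qed

end

theorem theorem6p5: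
  fixes X :: "'a set"
    and prec :: "'a \<Rightarrow> 'a \<Rightarrow> bool" (infix "\<prec>" 50)
    and z1 z2 z3 :: 'a
    and n k l :: nat
    and F :: "nat \<Rightarrow> nat \<Rightarrow> nat"
  defines "F \<equiv> lin_ext_gap_count X (\<prec>) z1 z2 z3"
  assumes poset: "finite_poset X (\<prec>)"
    and card: "card X = n"
    and elems: "z1 \<in> X" "z2 \<in> X" "z3 \<in> X"
    and dist: "z1 \<noteq> z2" "z2 \<noteq> z3" "z1 \<noteq> z3"
    and chain: "z1 \<prec> z2" "z2 \<prec> z3"
    and kl: "k \<ge> 1" "l \<ge> 1"
    and pos: "F (k + 2) l > 0"
    and zero: "F k (l + 2) = 0"
  shows "real (F (k + 1) l) * real (F k (l + 1)) \<ge>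
    real (F k l) * real (F (k + 1) (l + 1)) *
      (1 / 2 + 1 / (16 * real n * real k * (real l)\<^sup>2))"
proof -
  \<comment> \<open>Restricting to \<open>X\<close> gives a strict order on the whole type with the
    same linear extensions.\<close>
  define lt where "lt = (\<lambda>x y. x \<in> X \<and> y \<in> X \<and> prec x y)"
  interpret three_chain lt z1 X z2 z3
  proof unfold_locales
    show "\<not> lt x x" for x
      using poset by (auto simp: lt_def finite_poset_def irreflp_on_def)
    show "lt x y \<Longrightarrow> lt y w \<Longrightarrow> lt x w" for x y w
      using poset unfolding lt_def finite_poset_def transp_on_def by blast
  qed (use poset elems chain in \<open>simp_all add: lt_def finite_poset_def\<close>)
  have "linear_extensions X (\<prec>) = linear_extensions X lt"
    by (auto simp: linear_extensions_def lt_def)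
  then have F: "F (Suc a) (Suc b) = card (gaplists a b)" for a b
    unfolding F_def gap_count_eq_card_gaplists[symmetric] by (simp add: lin_ext_gap_count_def)
  obtain k' l' where kl': "k = Suc k'" "l = Suc l'" using kl by (cases k; cases l) auto
  have fin: "finite (gaplists a b)" for a b
    by (rule finite_subset[OF _ finite_linexts[OF finite_X]]) (auto simp: gaplists_def)
  have "gaplists k' (l' + 2) = {}" using zero F[of k' "l' + 2"] fin by (simp add: kl')
  from gaplists_inequality[OF card this]
  \<comment> \<open>Gaps are one less than differences of positions, so the factor
    \<open>k + 1\<close> for words is \<open>k\<close> here.\<close>
  have main: "real (F k l) * real (F (k + 1) (l + 1)) * (1 / 2 + 1 / (8 * real n * real k))
      \<le> real (F (k + 1) l) * real (F k (l + 1))"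
    using F[of k' l'] F[of "k' + 1" l'] F[of k' "l' + 1"] F[of "k' + 1" "l' + 1"] by (simp add: kl' add.commute)
  have "n > 0" using card elems finite_X by (auto simp: card_gt_0_iff)
  \<comment> \<open>As \<open>l \<ge> 1\<close>, the constant
    \<open>1 / (8 * real n * real k)\<close> is at least the one required.\<close>
  have "8 * real n * real k * 1 \<le> 8 * real n * real k * (2 * (real l)\<^sup>2)"
    using kl by (intro mult_left_mono) (auto intro: order_trans[of 1 "2 * 1"])
  then have "1 / (16 * real n * real k * (real l)\<^sup>2) \<le> 1 / (8 * real n * real k)"
    using kl \<open>n > 0\<close> by (intro divide_left_mono) auto
  then have "real (F k l) * real (F (k + 1) (l + 1)) * (1 / 2 + 1 / (16 * real n * real k * (real l)\<^sup>2))
      \<le> real (F k l) * real (F (k + 1) (l + 1)) * (1 / 2 + 1 / (8 * real n * real k))"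
    by (intro mult_left_mono) auto
  with main show ?thesis by simp
qed

end
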